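(* Let $M$ be a connected compact Riemannian manifold, let $1<\lambda<\Gamma$, and let $f_\infty=(f_n)_{n\ge0}$ be a sequence of maps $f_n\in\mathcal{E}(\lambda,\Gamma)$. Then the nonautonomous dynamical system $(M,f_\infty)$ is strongly uniformly expansive.
   Context: $\mathcal{E}(\lambda,\Gamma)$ is the set of $f\in C^2(M,M)$ such that $|Df(v)|\ge\lambda|v|$ for all $v\in TM$ and $\|f\|_{C^2}\le\Gamma$ (the $C^2$-norm bounds the norms of the first and second derivatives of $f$ with respect to the Riemannian metric; in particular $|Df(v)|\le\Gamma|v|$). $d$ is the Riemannian distance. Put $f_i^j:=f_{i+j-1}\circ\cdots\circ f_i$, $f_i^0=\mathrm{id}$, and $d_{i,N}(x,y):=\max_{0\le j\le N}d(f_i^j(x),f_i^j(y))$. The system $(M,f_\infty)$ is strongly uniformly expansive if there is $\delta>0$ such that for every $\varepsilon>0$ there is an integer $N\ge1$ such that for all $i\ge0$ and $x,y\in M$: $d_{i,N}(x,y)<\delta$ implies $d(x,y)<\varepsilon$. *)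

theory Defs
  imports "HOL-Analysis.Analysis"
begin

section \<open>Functions of class \<open>C\<^sup>k\<close> on open subsets of Euclidean space\<close>

text \<open>
  Meant for open \<open>S\<close> and finite-dimensional domain: there, \<open>C\<^sup>k\<^sup>+\<^sup>1\<close> means differentiable with
  all directional derivatives of class \<open>C\<^sup>k\<close>.
\<close>

primrec Ck_on ::
  "nat \<Rightarrow> 'e set \<Rightarrow> ('e::euclidean_space \<Rightarrow> 'b::real_normed_vector) \<Rightarrow> bool" where
  "Ck_on 0 S F \<longleftrightarrow> continuous_on S F"
| "Ck_on (Suc k) S F \<longleftrightarrow>
     (\<forall>x\<in>S. F differentiable (at x)) \<and>
     (\<forall>v. Ck_on k S (\<lambda>x. frechet_derivative F (at x) v))"

definition smooth_on :: "'e set \<Rightarrow> ('e::euclidean_space \<Rightarrow> 'b::real_normed_vector) \<Rightarrow> bool" where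
  "smooth_on S F \<longleftrightarrow> (\<forall>k. Ck_on k S F)"


section \<open>Riemannian manifolds\<close>

text \<open>A chart consists of its domain and its coordinate map (relevant only on the domain).\<close>

type_synonym ('a, 'e) chart = "'a set \<times> ('a \<Rightarrow> 'e)"

abbreviation cdom :: "('a, 'e) chart \<Rightarrow> 'a set" where
  "cdom c \<equiv> fst c"

abbreviation cmap :: "('a, 'e) chart \<Rightarrow> 'a \<Rightarrow> 'e" where
  "cmap c \<equiv> snd c"

abbreviation cinv :: "('a, 'e) chart \<Rightarrow> 'e \<Rightarrow> 'a" where
  "cinv c \<equiv> inv_into (cdom c) (cmap c)"

definition is_chart :: "'a::t2_space set \<Rightarrow> ('a, 'e::euclidean_space) chart \<Rightarrow> bool" where
  "is_chart M c \<longleftrightarrow>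
     openin (top_of_set M) (cdom c) \<and> open (cmap c ` cdom c) \<and>
     homeomorphism (cdom c) (cmap c ` cdom c) (cmap c) (cinv c)"

text \<open>
  Coordinate expression of a map between manifolds, and the coordinate expression of its tangent
  map at \<open>p\<close>. A tangent vector at \<open>p\<close> is represented, in each chart \<open>c\<close> around \<open>p\<close>, by its
  coordinate vector in \<open>'e\<close>; two charts \<open>c\<close>, \<open>c'\<close> are related by \<open>v \<mapsto> tangent_map c id c' p v\<close>.
\<close>

definition loc_rep ::
  "('a, 'e) chart \<Rightarrow> ('a \<Rightarrow> 'a) \<Rightarrow> ('a, 'e) chart \<Rightarrow> 'e \<Rightarrow> 'e" where
  "loc_rep c f c' = cmap c' \<circ> f \<circ> cinv c"

definition tangent_map ::
  "('a, 'e::euclidean_space) chart \<Rightarrow> ('a \<Rightarrow> 'a) \<Rightarrow> ('a, 'e) chart \<Rightarrow> 'a \<Rightarrow> 'e \<Rightarrow> 'e" where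
  "tangent_map c f c' p v = frechet_derivative (loc_rep c f c') (at (cmap c p)) v"

text \<open>
  \<open>g c p u v\<close> is the inner product of the tangent vectors at \<open>p\<close> whose coordinate vectors in the
  chart \<open>c\<close> are \<open>u\<close> and \<open>v\<close>.
\<close>

type_synonym ('a, 'e) metric_tensor = "('a, 'e) chart \<Rightarrow> 'a \<Rightarrow> 'e \<Rightarrow> 'e \<Rightarrow> real"

text \<open>
  A smooth manifold without boundary, modelled on \<open>'e\<close>, with a smooth Riemannian metric. The
  underlying space \<open>M\<close> carries the subspace topology of its ambient Hausdorff space.
\<close>

locale riemannian_manifold =
  fixes M :: "'a::t2_space set"
    and A :: "('a, 'e::euclidean_space) chart set"
    and g :: "('a, 'e) metric_tensor"
  assumes charts: "\<And>c. c \<in> A \<Longrightarrow> is_chart M c"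
    and covering: "(\<Union>c\<in>A. cdom c) = M"
    and compatible: "\<And>c c'. c \<in> A \<Longrightarrow> c' \<in> A \<Longrightarrow>
          smooth_on (cmap c ` (cdom c \<inter> cdom c')) (loc_rep c id c')"
    and metric_bilinear: "\<And>c p. c \<in> A \<Longrightarrow> p \<in> cdom c \<Longrightarrow> bilinear (g c p)"
    and metric_sym: "\<And>c p u v. c \<in> A \<Longrightarrow> p \<in> cdom c \<Longrightarrow> g c p u v = g c p v u"
    and metric_pos: "\<And>c p v. c \<in> A \<Longrightarrow> p \<in> cdom c \<Longrightarrow> v \<noteq> 0 \<Longrightarrow> g c p v v > 0"
    and metric_smooth: "\<And>c u v. c \<in> A \<Longrightarrow>
          smooth_on (cmap c ` cdom c) (\<lambda>x. g c (cinv c x) u v)"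
    and metric_transform: "\<And>c c' p u v. c \<in> A \<Longrightarrow> c' \<in> A \<Longrightarrow> p \<in> cdom c \<inter> cdom c' \<Longrightarrow>
          g c p u v = g c' p (tangent_map c id c' p u) (tangent_map c id c' p v)"

definition tnorm :: "('a, 'e) metric_tensor \<Rightarrow> ('a, 'e) chart \<Rightarrow> 'a \<Rightarrow> 'e \<Rightarrow> real" where
  "tnorm g c p v = sqrt (g c p v v)"


section \<open>Riemannian distance\<close>

definition C1_curve :: "('a, 'e::euclidean_space) chart set \<Rightarrow> real \<Rightarrow> real \<Rightarrow> (real \<Rightarrow> 'a) \<Rightarrow> bool"
  where
  "C1_curve A s t \<gamma> \<longleftrightarrow>
     (\<forall>c\<in>A. let T = {\<tau> \<in> {s..t}. \<gamma> \<tau> \<in> cdom c} in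
        \<exists>D. continuous_on T D \<and>
          (\<forall>\<tau>\<in>T. ((cmap c \<circ> \<gamma>) has_vector_derivative D \<tau>) (at \<tau> within {s..t})))"

text \<open>
  A continuous curve in \<open>M\<close>, defined on \<open>[a,b]\<close>, which is \<open>C\<^sup>1\<close> (up to the end points, with
  one-sided derivatives there) on every closed subinterval without interior break points.
\<close>

definition piecewise_C1_curve ::
  "'a::t2_space set \<Rightarrow> ('a, 'e::euclidean_space) chart set \<Rightarrow> real \<Rightarrow> real \<Rightarrow> (real \<Rightarrow> 'a) \<Rightarrow> bool"
  where
  "piecewise_C1_curve M A a b \<gamma> \<longleftrightarrow>
     continuous_on {a..b} \<gamma> \<and> \<gamma> ` {a..b} \<subseteq> M \<and>
     (\<exists>B. finite B \<and>
        (\<forall>s t. a \<le> s \<and> s < t \<and> t \<le> b \<and> {s<..<t} \<inter> B = {} \<longrightarrow> C1_curve A s t \<gamma>))"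

text \<open>
  The norm of the velocity does not depend on the chosen chart. Its value at the (finitely many)
  times where \<open>\<gamma>\<close> is not differentiable is irrelevant for the length.
\<close>

definition speed ::
  "('a, 'e::euclidean_space) chart set \<Rightarrow> ('a, 'e) metric_tensor \<Rightarrow> (real \<Rightarrow> 'a) \<Rightarrow> real \<Rightarrow> real"
  where
  "speed A g \<gamma> \<tau> =
     (let c = (SOME c. c \<in> A \<and> \<gamma> \<tau> \<in> cdom c)
      in tnorm g c (\<gamma> \<tau>) (vector_derivative (cmap c \<circ> \<gamma>) (at \<tau>)))"

definition curve_length ::
  "('a, 'e::euclidean_space) chart set \<Rightarrow> ('a, 'e) metric_tensor \<Rightarrow>
     real \<Rightarrow> real \<Rightarrow> (real \<Rightarrow> 'a) \<Rightarrow> real"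
  where
  "curve_length A g a b \<gamma> = integral {a..b} (speed A g \<gamma>)"

text \<open>Meant for connected \<open>M\<close>, where the set of lengths is nonempty for all \<open>x\<close>, \<open>y\<close> in \<open>M\<close>.\<close>

definition riem_dist ::
  "'a::t2_space set \<Rightarrow> ('a, 'e::euclidean_space) chart set \<Rightarrow> ('a, 'e) metric_tensor \<Rightarrow>
     'a \<Rightarrow> 'a \<Rightarrow> real"
  where
  "riem_dist M A g x y =
     Inf {curve_length A g a b \<gamma> | a b \<gamma>.
            a \<le> b \<and> piecewise_C1_curve M A a b \<gamma> \<and> \<gamma> a = x \<and> \<gamma> b = y}"


section \<open>\<open>C\<^sup>2\<close> maps and their \<open>C\<^sup>2\<close>-norm\<close>

definition C2_map ::
  "'a::t2_space set \<Rightarrow> ('a, 'e::euclidean_space) chart set \<Rightarrow> ('a \<Rightarrow> 'a) \<Rightarrow> bool" where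
  "C2_map M A f \<longleftrightarrow>
     f ` M \<subseteq> M \<and> continuous_on M f \<and>
     (\<forall>c\<in>A. \<forall>c'\<in>A. Ck_on 2 (cmap c ` {p \<in> cdom c. f p \<in> cdom c'}) (loc_rep c f c'))"

text \<open>
  \<open>metric_deriv g c p w u v\<close> is the derivative in direction \<open>w\<close> of the metric coefficient \<open>g(u,v)\<close>
  (\<open>u\<close>, \<open>v\<close> constant in the chart), and \<open>christoffel g c p u v\<close> is the covariant derivative of the
  constant field \<open>v\<close> in direction \<open>u\<close> for the Levi-Civita connection, given by Koszul's formula.
\<close>

definition metric_deriv ::
  "('a, 'e::euclidean_space) metric_tensor \<Rightarrow> ('a, 'e) chart \<Rightarrow> 'a \<Rightarrow> 'e \<Rightarrow> 'e \<Rightarrow> 'e \<Rightarrow> real" where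
  "metric_deriv g c p w u v = frechet_derivative (\<lambda>x. g c (cinv c x) u v) (at (cmap c p)) w"

definition christoffel ::
  "('a, 'e::euclidean_space) metric_tensor \<Rightarrow> ('a, 'e) chart \<Rightarrow> 'a \<Rightarrow> 'e \<Rightarrow> 'e \<Rightarrow> 'e" where
  "christoffel g c p u v =
     (THE z. \<forall>w. 2 * g c p z w =
        metric_deriv g c p u v w + metric_deriv g c p v u w - metric_deriv g c p w u v)"

text \<open>
  The second derivative \<open>\<nabla>Df\<close> of \<open>f : M \<rightarrow> M\<close>, a symmetric bilinear map from \<open>T\<^sub>pM\<close> to
  the tangent space at \<open>f p\<close>: with \<open>F\<close> the coordinate expression of \<open>f\<close>,
  \<open>\<nabla>Df(u,v) = D\<^sup>2F(u,v) + \<Gamma>(DF u, DF v) - DF(\<Gamma>(u,v))\<close>.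
\<close>

definition second_deriv ::
  "('a, 'e::euclidean_space) metric_tensor \<Rightarrow> ('a, 'e) chart \<Rightarrow> ('a \<Rightarrow> 'a) \<Rightarrow> ('a, 'e) chart \<Rightarrow>
     'a \<Rightarrow> 'e \<Rightarrow> 'e \<Rightarrow> 'e"
  where
  "second_deriv g c f c' p u v =
     frechet_derivative (\<lambda>x. frechet_derivative (loc_rep c f c') (at x) v) (at (cmap c p)) u
     + christoffel g c' (f p) (tangent_map c f c' p u) (tangent_map c f c' p v)
     - tangent_map c f c' p (christoffel g c p u v)"

text \<open>
  Maximum of the suprema over \<open>M\<close> of the operator norms of \<open>Df\<close> and \<open>\<nabla>Df\<close>. It takes values in the
  extended reals, so that no finiteness has to be established beforehand.
\<close>

definition C2_norm ::
  "('a, 'e::euclidean_space) chart set \<Rightarrow> ('a, 'e) metric_tensor \<Rightarrow> ('a \<Rightarrow> 'a) \<Rightarrow> ereal" where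
  "C2_norm A g f = max
     (Sup {ereal (tnorm g c' (f p) (tangent_map c f c' p v)) | c c' p v.
             c \<in> A \<and> c' \<in> A \<and> p \<in> cdom c \<and> f p \<in> cdom c' \<and> tnorm g c p v \<le> 1})
     (Sup {ereal (tnorm g c' (f p) (second_deriv g c f c' p u v)) | c c' p u v.
             c \<in> A \<and> c' \<in> A \<and> p \<in> cdom c \<and> f p \<in> cdom c' \<and>
             tnorm g c p u \<le> 1 \<and> tnorm g c p v \<le> 1})"

definition expanding_maps ::
  "'a::t2_space set \<Rightarrow> ('a, 'e::euclidean_space) chart set \<Rightarrow> ('a, 'e) metric_tensor \<Rightarrow>
     real \<Rightarrow> real \<Rightarrow> ('a \<Rightarrow> 'a) set"
  where
  "expanding_maps M A g lam \<Gamma> =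
     {f. C2_map M A f \<and>
         (\<forall>c\<in>A. \<forall>c'\<in>A. \<forall>p v. p \<in> cdom c \<and> f p \<in> cdom c' \<longrightarrow>
            tnorm g c' (f p) (tangent_map c f c' p v) \<ge> lam * tnorm g c p v) \<and>
         C2_norm A g f \<le> ereal \<Gamma>}"


section \<open>Nonautonomous dynamical systems\<close>

primrec orbit_map :: "(nat \<Rightarrow> 'a \<Rightarrow> 'a) \<Rightarrow> nat \<Rightarrow> nat \<Rightarrow> 'a \<Rightarrow> 'a" where
  "orbit_map f i 0 = id"
| "orbit_map f i (Suc j) = f (i + j) \<circ> orbit_map f i j"

definition bowen_dist ::
  "('a \<Rightarrow> 'a \<Rightarrow> real) \<Rightarrow> (nat \<Rightarrow> 'a \<Rightarrow> 'a) \<Rightarrow> nat \<Rightarrow> nat \<Rightarrow> 'a \<Rightarrow> 'a \<Rightarrow> real" where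
  "bowen_dist d f i N x y = (MAX j\<in>{0..N}. d (orbit_map f i j x) (orbit_map f i j y))"

definition strongly_uniformly_expansive ::
  "'a set \<Rightarrow> ('a \<Rightarrow> 'a \<Rightarrow> real) \<Rightarrow> (nat \<Rightarrow> 'a \<Rightarrow> 'a) \<Rightarrow> bool" where
  "strongly_uniformly_expansive M d f \<longleftrightarrow>
     (\<exists>\<delta>>0. \<forall>\<epsilon>>0. \<exists>N\<ge>1. \<forall>i. \<forall>x\<in>M. \<forall>y\<in>M. bowen_dist d f i N x y < \<delta> \<longrightarrow> d x y < \<epsilon>)"

end

theory Submission
  imports Defs
begin

text \<open>
  The result rests on one uniform fact: there is a scale \<open>\<delta> > 0\<close>, common to all maps \<open>h\<close> of the
  class, such that \<open>d x y < \<delta>\<close> and \<open>d (h x) (h y) < \<delta>\<close> together force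
  \<open>lam * d x y \<le> d (h x) (h y)\<close> (\<open>uniform_expansion_at_small_scales\<close>). Once this is known, two orbits
  that stay \<open>\<delta>\<close>-close during \<open>N\<close> steps satisfy \<open>lam ^ N * d x y < \<delta>\<close>, and any \<open>N\<close> with
  \<open>\<delta> < lam ^ N * \<epsilon>\<close> works for \<open>\<epsilon>\<close>.

  To prove the uniform fact one lifts curves. If a short curve \<open>\<gamma>\<close> from \<open>h x\<close> to \<open>h y\<close> can be lifted
  through \<open>h\<close> to a curve \<open>\<sigma>\<close> from \<open>x\<close> to \<open>y\<close>, then \<open>h \<circ> \<sigma> = \<gamma>\<close> and the expansion of \<open>Dh\<close> give
  \<open>lam * length \<sigma> \<le> length \<gamma>\<close>; taking the infimum over \<open>\<gamma>\<close> gives the inequality between distances.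
  That such a lift ends at \<open>y\<close>, and not at another preimage of \<open>h y\<close>, follows from injectivity of
  \<open>h\<close> near \<open>x\<close>, on a ball whose radius depends neither on \<open>x\<close> nor on \<open>h\<close>. This is where the bound on second
  derivatives enters: in coordinates the derivative of \<open>h\<close> varies at a bounded rate and is bounded
  below, so on a ball of uniform radius it stays close to an invertible linear map. Hence \<open>h\<close> has there
  a \<open>C\<^sup>1\<close> inverse defined on a ball of uniform radius (\<open>quantitative_inverse\<close>), and composing \<open>\<gamma>\<close> with
  this inverse is the lift (\<open>lift_curve_through_local_inverse\<close>).

  The uniformity comes from compactness (\<open>uniformly_controlled_charts\<close>): one constant \<open>\<kappa>\<close> serves
  around every point, in a suitable chart, for the size of the coordinate ball, for the comparison of
  the Riemannian and Euclidean norms, and for the Christoffel symbols. The latter are what relates the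
  covariant second derivative, which the \<open>C\<^sup>2\<close>-norm controls, to the second derivative in coordinates
  (\<open>second_derivative_bound\<close>). Distances are compared with coordinates by one estimate: a curve of
  length less than \<open>r / \<kappa>\<close> does not leave the coordinate ball of radius \<open>r\<close> around its starting point
  (\<open>short_curve_stays_in_chart_ball\<close>).
\<close>

section \<open>Calculus and linear algebra in Euclidean space\<close>

text \<open>
  The Riesz representation for a positive definite bilinear form: the map sending \<open>z\<close> to the vector
  of values \<open>B z i\<close> on the basis is linear and injective, hence onto. It makes the Christoffel symbols,
  which are defined by a description, well defined.
\<close>

lemma positive_definite_representation:
  fixes B :: "'e::euclidean_space \<Rightarrow> 'e \<Rightarrow> real"
  assumes B: "bilinear B" and pos: "\<And>v. v \<noteq> 0 \<Longrightarrow> B v v > 0" and l: "linear l"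
  shows "\<exists>!z. \<forall>w. B z w = l w"
proof -
  interpret L: linear "\<lambda>x. B x y" for y using B by (simp add: bilinear_def)
  interpret R: linear "\<lambda>y. B x y" for x using B by (simp add: bilinear_def)
  define T where "T z = (\<Sum>i\<in>Basis. B z i *\<^sub>R i)" for z
  have Ti: "T z \<bullet> i = B z i" if "i \<in> Basis" for z i
    using that by (simp add: T_def inner_sum_left_Basis)
  have zero: "z = 0" if "\<And>w. B z w = 0" for z using that[of z] pos[of z] by fastforce
  have T: "linear T"
    by (rule linearI) (simp_all add: T_def L.add L.scale scaleR_add_left sum.distrib scaleR_sum_right)
  have on_basis: "B z w = l w" if "\<And>i. i \<in> Basis \<Longrightarrow> B z i = l i" "linear l" for z w l
    using linear_eq_stdbasis[of "B z" l] that R.linear_axioms by metis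
  have "inj T"
    unfolding linear_injective_0[OF T]
  proof (intro allI impI)
    fix z assume "T z = 0"
    then have "B z w = 0" for w
      using on_basis[of z "\<lambda>_. 0" w] Ti[of _ z] by (simp add: linear_zero)
    then show "z = 0" by (rule zero)
  qed
  then have "surj T" using T linear_injective_imp_surjective by blast
  then obtain z where z: "T z = (\<Sum>i\<in>Basis. l i *\<^sub>R i)" by (metis surjD)
  have "B z i = l i" if "i \<in> Basis" for i
    using Ti[OF that, of z] that by (simp add: z)
  then have ex: "\<forall>w. B z w = l w" using on_basis l by blast
  moreover have "y = z" if "\<forall>w. B y w = l w" for y
  proof -
    have "y - z = 0" by (rule zero) (simp add: L.diff that ex)
    then show ?thesis by simp
  qed
  ultimately show ?thesis by blast
qed

lemma Ck_on_Suc_has_derivative: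
  "Ck_on (Suc k) S F \<Longrightarrow> x \<in> S \<Longrightarrow> (F has_derivative frechet_derivative F (at x)) (at x)"
  by (simp add: frechet_derivative_works)

lemma Ck_on_imp_continuous_on:
  assumes "Ck_on k S F" shows "continuous_on S F"
  using assms by (cases k)
    (auto intro!: continuous_at_imp_continuous_on differentiable_imp_continuous_within)

lemma Ck_on_continuous_derivative:
  assumes F: "Ck_on (Suc k) S F" and z: "continuous_on X z" "z ` X \<subseteq> S" and v: "continuous_on X v"
  shows "continuous_on X (\<lambda>x. frechet_derivative F (at (z x)) (v x))"
proof -
  have "continuous_on S (\<lambda>y. frechet_derivative F (at y) i)" for i
    using F by (auto intro: Ck_on_imp_continuous_on)
  then have "continuous_on X (\<lambda>x. frechet_derivative F (at (z x)) i)" for i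
    by (rule continuous_on_compose2[OF _ z])
  then have "continuous_on X (\<lambda>x. \<Sum>i\<in>Basis. (v x \<bullet> i) *\<^sub>R frechet_derivative F (at (z x)) i)"
    by (intro continuous_intros v)
  then show ?thesis
  proof (rule continuous_on_eq)
    fix x assume "x \<in> X"
    then have "linear (frechet_derivative F (at (z x)))"
      using F z(2) by (intro linear_frechet_derivative) auto
    then have "frechet_derivative F (at (z x)) (\<Sum>i\<in>Basis. (v x \<bullet> i) *\<^sub>R i) =
      (\<Sum>i\<in>Basis. (v x \<bullet> i) *\<^sub>R frechet_derivative F (at (z x)) i)"
      by (simp add: linear_sum linear_scale)
    then show "(\<Sum>i\<in>Basis. (v x \<bullet> i) *\<^sub>R frechet_derivative F (at (z x)) i) =
      frechet_derivative F (at (z x)) (v x)"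
      by (simp add: euclidean_representation)
  qed
qed

text \<open>
  Velocities are only known away from break points and end points, so speeds are compared up to
  finitely many times.
\<close>

lemma integral_mono_except_finite:
  fixes u w :: "real \<Rightarrow> real"
  assumes "u integrable_on {a..b}" "w integrable_on {a..b}" "finite B"
    and le: "\<And>x. x \<in> {a<..<b} - B \<Longrightarrow> u x \<le> w x"
  shows "integral {a..b} u \<le> integral {a..b} w"
proof -
  define u' where "u' x = (if x \<in> B \<union> {a, b} then w x else u x)" for x
  have fin: "finite (B \<union> {a, b})" using assms(3) by simp
  have "u' integrable_on {a..b}"
    using integrable_spike_finite[OF fin _ assms(1), of u'] by (simp add: u'_def)
  moreover have "integral {a..b} u = integral {a..b} u'"
    by (rule integral_spike[OF negligible_finite[OF fin]]) (simp add: u'_def)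
  moreover have "u' x \<le> w x" if "x \<in> {a..b}" for x
    using that le[of x] by (auto simp: u'_def)
  ultimately show ?thesis using Henstock_Kurzweil_Integration.integral_le[OF _ assms(2), of u'] by simp
qed

text \<open>
  The map \<open>F - F' z0\<close> is Lipschitz with constant \<open>\<alpha> / 2\<close> by the mean value inequality, which costs half
  of the lower bound \<open>\<alpha>\<close> of \<open>F' z0\<close>; this is the first claim. In particular \<open>F\<close> is injective, so it is open
  by invariance of domain, and a connectedness argument shows that it covers a ball of explicit radius.
\<close>

lemma quantitative_inverse:
  fixes F :: "'e::euclidean_space \<Rightarrow> 'e"
  assumes "\<rho> > 0" "\<alpha> > 0"
    and der: "\<And>z. z \<in> ball z0 \<rho> \<Longrightarrow> (F has_derivative F' z) (at z)"
    and low: "\<And>v. \<alpha> * norm v \<le> norm (F' z0 v)"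
    and near: "\<And>z v. z \<in> ball z0 \<rho> \<Longrightarrow> norm (F' z v - F' z0 v) \<le> \<alpha> / 2 * norm v"
  shows "\<And>z w. z \<in> ball z0 \<rho> \<Longrightarrow> w \<in> ball z0 \<rho> \<Longrightarrow> \<alpha> / 2 * norm (z - w) \<le> norm (F z - F w)"
    and "ball (F z0) (\<alpha> * \<rho> / 2) \<subseteq> F ` ball z0 \<rho>"
proof -
  have z0: "z0 \<in> ball z0 \<rho>" using assms(1) by simp
  show low': "\<alpha> / 2 * norm (z - w) \<le> norm (F z - F w)"
    if zw: "z \<in> ball z0 \<rho>" "w \<in> ball z0 \<rho>" for z w
  proof -
    have bl: "bounded_linear (F' z0)" using der[OF z0] has_derivative_bounded_linear by blast
    have "norm ((F z - F' z0 z) - (F w - F' z0 w)) \<le> \<alpha> / 2 * norm (z - w)"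
    proof (rule differentiable_bound[OF convex_ball _ _ zw])
      fix y assume y: "y \<in> ball z0 \<rho>"
      show "((\<lambda>z. F z - F' z0 z) has_derivative (\<lambda>v. F' y v - F' z0 v)) (at y within ball z0 \<rho>)"
        using has_derivative_at_withinI[OF der[OF y]] bounded_linear_imp_has_derivative[OF bl]
        by (rule has_derivative_diff)
      show "onorm (\<lambda>v. F' y v - F' z0 v) \<le> \<alpha> / 2" by (rule onorm_le) (rule near[OF y])
    qed
    moreover have "\<alpha> * norm (z - w) \<le> norm (F' z0 z - F' z0 w)"
      using low[of "z - w"] bl by (simp add: bounded_linear.linear linear_diff)
    moreover have "norm (F' z0 z - F' z0 w) \<le>
       norm (F z - F w) + norm ((F z - F' z0 z) - (F w - F' z0 w))"
      by (rule order_trans[OF _ norm_triangle_ineq4]) (simp add: algebra_simps)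
    moreover have "\<alpha> * norm (z - w) = \<alpha> / 2 * norm (z - w) + \<alpha> / 2 * norm (z - w)"
      by (simp add: field_simps)
    ultimately show ?thesis by linarith
  qed
  show "ball (F z0) (\<alpha> * \<rho> / 2) \<subseteq> F ` ball z0 \<rho>"
  proof
    fix y assume "y \<in> ball (F z0) (\<alpha> * \<rho> / 2)"
    then have "2 * dist (F z0) y / \<alpha> < \<rho>" using assms(2) by (simp add: field_simps)
    then obtain r where r: "2 * dist (F z0) y / \<alpha> < r" "r < \<rho>" using dense by blast
    have "0 \<le> 2 * dist (F z0) y / \<alpha>" using assms(2) by simp
    then have "r > 0" using r(1) by linarith
    define U where "U = ball (F z0) (\<alpha> * r / 2)"
    have yU: "y \<in> U" using r(1) assms(2) by (simp add: U_def field_simps)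
    have sub: "cball z0 r \<subseteq> ball z0 \<rho>" using r(2) by auto
    have sub': "ball z0 r \<subseteq> ball z0 \<rho>" using r(2) by auto
    have contF: "continuous_on (ball z0 \<rho>) F"
      using der has_derivative_continuous by (intro continuous_at_imp_continuous_on) blast
    have "inj_on F (ball z0 \<rho>)"
    proof (rule inj_onI)
      fix z w assume "z \<in> ball z0 \<rho>" "w \<in> ball z0 \<rho>" "F z = F w"
      then have "\<alpha> / 2 * norm (z - w) \<le> 0" using low'[of z w] by simp
      then show "z = w" using assms(2) by (simp add: mult_le_0_iff)
    qed
    then have "open (F ` ball z0 r)"
      using contF sub' by (intro invariance_of_domain) (auto intro: continuous_on_subset inj_on_subset)
    then have "openin (top_of_set U) (U \<inter> F ` ball z0 r)" by (simp add: openin_open_Int)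
    \<comment> \<open>The image of the sphere of radius \<open>r\<close> is at distance at least \<open>\<alpha> * r / 2\<close> from \<open>F z0\<close>, so it
      misses \<open>U\<close>; hence the image of the ball is open and closed in the connected set \<open>U\<close>.\<close>
    moreover have "U \<inter> F ` ball z0 r = U \<inter> F ` cball z0 r"
    proof -
      have "z \<in> ball z0 r" if "z \<in> cball z0 r" "F z \<in> U" for z
      proof -
        have "\<alpha> / 2 * norm (z0 - z) \<le> norm (F z0 - F z)"
          using low'[OF z0, of z] that(1) sub by blast
        also have "\<dots> < \<alpha> * r / 2" using that(2) by (simp add: U_def dist_norm)
        finally show ?thesis using assms(2) by (simp add: dist_norm)
      qed
      then show ?thesis by auto
    qed
    moreover have "closed (F ` cball z0 r)"
      using contF sub by (intro compact_imp_closed compact_continuous_image) (auto intro: continuous_on_subset)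
    then have "closedin (top_of_set U) (U \<inter> F ` cball z0 r)" by (simp add: closedin_closed_Int)
    moreover have "connected U" by (simp add: U_def)
    moreover have "F z0 \<in> U \<inter> F ` ball z0 r" using \<open>r > 0\<close> assms(2) by (simp add: U_def)
    ultimately have "U \<inter> F ` ball z0 r = U" unfolding connected_clopen by (metis empty_iff)
    then show "y \<in> F ` ball z0 \<rho>" using yU sub' by blast
  qed
qed

lemma linear_inverse_of_lower_bound:
  fixes T :: "'e::euclidean_space \<Rightarrow> 'e"
  assumes "linear T" "\<beta> > 0" "\<And>v. \<beta> * norm v \<le> norm (T v)"
  obtains T' where "linear T'" "\<And>v. T' (T v) = v" "\<And>v. T (T' v) = v"
proof -
  have "v = 0" if "T v = 0" for v using assms(2) assms(3)[of v] that by (simp add: mult_le_0_iff)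
  then have "inj T" using linear_injective_0[OF assms(1)] by blast
  then show ?thesis using linear_injective_isomorphism[OF assms(1)] that by blast
qed

lemma positive_half_less: "0 < a \<Longrightarrow> a / 2 < (a::real)"
  by simp

context riemannian_manifold
begin

section \<open>Charts and the metric in coordinates\<close>

lemma chart_homeomorphism:
  "c \<in> A \<Longrightarrow> homeomorphism (cdom c) (cmap c ` cdom c) (cmap c) (cinv c)"
  using charts by (auto simp: is_chart_def)

lemma open_chart_image: "c \<in> A \<Longrightarrow> open (cmap c ` cdom c)"
  using charts by (auto simp: is_chart_def)

lemma openin_chart_domain: "c \<in> A \<Longrightarrow> openin (top_of_set M) (cdom c)"
  using charts by (auto simp: is_chart_def)

lemma chart_domain_subset: "c \<in> A \<Longrightarrow> cdom c \<subseteq> M"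
  using openin_chart_domain openin_imp_subset by blast

lemma cinv_cmap: "c \<in> A \<Longrightarrow> p \<in> cdom c \<Longrightarrow> cinv c (cmap c p) = p"
  using chart_homeomorphism[of c] homeomorphism_apply1 by fastforce

lemma cinv_in_domain: "z \<in> cmap c ` cdom c \<Longrightarrow> cinv c z \<in> cdom c"
  by (rule inv_into_into)

lemma cmap_cinv: "z \<in> cmap c ` cdom c \<Longrightarrow> cmap c (cinv c z) = z"
  by (rule f_inv_into_f)

lemma open_cmap_image:
  assumes "c \<in> A" "openin (top_of_set M) U"
  shows "open (cmap c ` (cdom c \<inter> U))"
proof -
  have "openin (top_of_set (cdom c)) (cdom c \<inter> U)"
    using assms(2) chart_domain_subset[OF assms(1)]
    by (auto simp: openin_open)
  then have "openin (top_of_set (cmap c ` cdom c)) (cmap c ` (cdom c \<inter> U))"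
    using chart_homeomorphism[OF assms(1)] homeomorphism_imp_open_map by blast
  then show ?thesis
    using open_chart_image[OF assms(1)] openin_open_trans by blast
qed

lemma openin_cinv_image:
  assumes "c \<in> A" "open W" "W \<subseteq> cmap c ` cdom c"
  shows "openin (top_of_set M) (cinv c ` W)"
proof -
  have "openin (top_of_set (cmap c ` cdom c)) W"
    using assms(2,3) by (simp add: open_subset)
  moreover have "homeomorphism (cmap c ` cdom c) (cdom c) (cinv c) (cmap c)"
    using chart_homeomorphism[OF assms(1)] by (simp add: homeomorphism_symD)
  ultimately have "openin (top_of_set (cdom c)) (cinv c ` W)"
    using homeomorphism_imp_open_map by blast
  then show ?thesis
    using openin_chart_domain[OF assms(1)] openin_trans by blast
qed

lemma open_loc_rep_domain:
  assumes "c \<in> A" "c' \<in> A" "continuous_on M h" "h ` M \<subseteq> M"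
  shows "open (cmap c ` {p \<in> cdom c. h p \<in> cdom c'})"
proof -
  have "openin (top_of_set M) (M \<inter> h -` cdom c')"
    using assms(3,4) openin_chart_domain[OF assms(2)]
    by (meson continuous_openin_preimage image_subset_iff_funcset)
  then have "open (cmap c ` (cdom c \<inter> (M \<inter> h -` cdom c')))"
    by (rule open_cmap_image[OF assms(1)])
  moreover have "cdom c \<inter> (M \<inter> h -` cdom c') = {p \<in> cdom c. h p \<in> cdom c'}"
    using chart_domain_subset[OF assms(1)] by auto
  ultimately show ?thesis by simp
qed

lemma smooth_transition:
  assumes "c \<in> A" "c' \<in> A"
  shows "Ck_on k (cmap c ` {p \<in> cdom c. id p \<in> cdom c'}) (loc_rep c id c')"
  using compatible[OF assms] by (auto simp: smooth_on_def Int_def)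

text \<open>
  The metric coefficients are smooth only for fixed vectors; expanding in the basis turns this into joint
  regularity in the point and both vectors.
\<close>

lemma metric_expand:
  assumes "c \<in> A" "p \<in> cdom c"
  shows "g c p u v = (\<Sum>i\<in>Basis. \<Sum>j\<in>Basis. (u \<bullet> i) * (v \<bullet> j) * g c p i j)"
proof -
  have b: "bilinear (g c p)" using metric_bilinear assms by blast
  have "g c p u v = g c p (\<Sum>i\<in>Basis. (u \<bullet> i) *\<^sub>R i) (\<Sum>j\<in>Basis. (v \<bullet> j) *\<^sub>R j)"
    by (simp add: euclidean_representation)
  also have "\<dots> = (\<Sum>(i,j)\<in>Basis\<times>Basis. g c p ((u \<bullet> i) *\<^sub>R i) ((v \<bullet> j) *\<^sub>R j))"
    by (rule bilinear_sum[OF b])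
  also have "\<dots> = (\<Sum>(i,j)\<in>Basis\<times>Basis. (u \<bullet> i) * (v \<bullet> j) * g c p i j)"
    by (simp add: bilinear_lmul[OF b] bilinear_rmul[OF b] ac_simps)
  finally show ?thesis unfolding sum.cartesian_product .
qed

lemma Ck_metric:
  assumes "c \<in> A"
  shows "Ck_on k (cmap c ` cdom c) (\<lambda>z. g c (cinv c z) u v)"
  using metric_smooth[OF assms] by (auto simp: smooth_on_def)

lemma continuous_metric:
  assumes c: "c \<in> A" and z: "continuous_on X z" "z ` X \<subseteq> cmap c ` cdom c"
    and u: "continuous_on X u" and v: "continuous_on X v"
  shows "continuous_on X (\<lambda>x. g c (cinv c (z x)) (u x) (v x))"
proof -
  have 1: "continuous_on X (\<lambda>x. g c (cinv c (z x)) i j)" for i j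
    using continuous_on_compose2[OF _ z] Ck_metric[OF c, of 0 i j] by auto
  have "continuous_on X (\<lambda>x. \<Sum>i\<in>Basis. \<Sum>j\<in>Basis. (u x \<bullet> i) * (v x \<bullet> j) * g c (cinv c (z x)) i j)"
    by (intro continuous_intros 1 u v)
  moreover have "g c (cinv c (z x)) (u x) (v x) =
     (\<Sum>i\<in>Basis. \<Sum>j\<in>Basis. (u x \<bullet> i) * (v x \<bullet> j) * g c (cinv c (z x)) i j)" if "x \<in> X" for x
    using z(2) that by (intro metric_expand c cinv_in_domain) auto
  ultimately show ?thesis by (subst continuous_on_cong[OF refl]) auto
qed

lemma metric_nonneg: "c \<in> A \<Longrightarrow> p \<in> cdom c \<Longrightarrow> g c p v v \<ge> 0"
  using metric_pos[of c p v] bilinear_rzero[OF metric_bilinear, of c p 0]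
  by (cases "v = 0") (auto intro: less_imp_le)

lemma tnorm_nonneg: "c \<in> A \<Longrightarrow> p \<in> cdom c \<Longrightarrow> tnorm g c p v \<ge> 0"
  by (simp add: tnorm_def metric_nonneg)

lemma tnorm_scaleR:
  assumes "c \<in> A" "p \<in> cdom c"
  shows "tnorm g c p (r *\<^sub>R v) = \<bar>r\<bar> * tnorm g c p v"
proof -
  have b: "bilinear (g c p)" using metric_bilinear assms by blast
  have "g c p (r *\<^sub>R v) (r *\<^sub>R v) = r\<^sup>2 * g c p v v"
    by (simp add: bilinear_lmul[OF b] bilinear_rmul[OF b] power2_eq_square)
  then show ?thesis by (simp add: tnorm_def real_sqrt_mult)
qed

text \<open>
  The Riemannian norm is continuous and positive on the compact product of \<open>K\<close> with the unit sphere, so it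
  attains positive extrema there; homogeneity extends the bounds to all vectors.
\<close>

lemma norm_tnorm_bounds_compact:
  assumes c: "c \<in> A" and K: "compact K" "K \<subseteq> cmap c ` cdom c"
  obtains \<kappa> where "\<kappa> > 0"
    "\<And>z v. z \<in> K \<Longrightarrow> norm v \<le> \<kappa> * tnorm g c (cinv c z) v"
    "\<And>z v. z \<in> K \<Longrightarrow> tnorm g c (cinv c z) v \<le> \<kappa> * norm v"
proof (cases "K = {}")
  case True then show ?thesis using that[of 1] by auto
next
  case False
  define X :: "('e \<times> 'e) set" where "X = K \<times> sphere 0 1"
  define q where "q w = tnorm g c (cinv c (fst w)) (snd w)" for w :: "'e \<times> 'e"
  have X: "compact X" "X \<noteq> {}"
    using K False unfolding X_def by (auto intro: compact_Times)
  have "continuous_on X q"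
    unfolding q_def tnorm_def using K(2)
    by (intro continuous_intros continuous_metric c) (auto simp: X_def)
  from continuous_attains_inf[OF X this] continuous_attains_sup[OF X this]
  obtain w1 w2 where w: "w1 \<in> X" "\<And>w. w \<in> X \<Longrightarrow> q w1 \<le> q w"
     "w2 \<in> X" "\<And>w. w \<in> X \<Longrightarrow> q w \<le> q w2" by auto
  have "snd w1 \<noteq> 0" "fst w1 \<in> cmap c ` cdom c" using w(1) K(2) by (auto simp: X_def)
  then have q1: "q w1 > 0"
    unfolding q_def tnorm_def using metric_pos[OF c cinv_in_domain] by simp
  define \<kappa> where "\<kappa> = max (1 / q w1) (q w2)"
  have k: "1 / q w1 \<le> \<kappa>" "q w2 \<le> \<kappa>" by (auto simp: \<kappa>_def)
  have "\<kappa> > 0" using k(1) q1 by (meson less_le_trans divide_pos_pos zero_less_one)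
  have main: "norm v \<le> \<kappa> * tnorm g c (cinv c z) v \<and> tnorm g c (cinv c z) v \<le> \<kappa> * norm v"
    if z: "z \<in> K" for z v
  proof (cases "v = 0")
    case True
    then show ?thesis using tnorm_scaleR[OF c cinv_in_domain, of z 0 v] z K(2) by auto
  next
    case False
    define e where "e = (1 / norm v) *\<^sub>R v"
    have e: "(z, e) \<in> X" using z False by (auto simp: X_def e_def)
    have v: "v = norm v *\<^sub>R e" using False by (simp add: e_def)
    have "tnorm g c (cinv c z) v = norm v * q (z, e)"
      using tnorm_scaleR[OF c cinv_in_domain, of z "norm v" e] z K(2) v by (auto simp: q_def)
    moreover have "1 \<le> \<kappa> * q (z, e)"
      using mult_mono[OF k(1) w(2)[OF e]] q1 \<open>\<kappa> > 0\<close> by simp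
    moreover have "q (z, e) \<le> \<kappa>" using w(4)[OF e] k(2) by simp
    ultimately show ?thesis
      using mult_left_mono[of 1 "\<kappa> * q (z, e)" "norm v"] mult_left_mono[of "q (z, e)" \<kappa> "norm v"]
      by (simp add: mult.commute ac_simps)
  qed
  then show ?thesis using that \<open>\<kappa> > 0\<close> by blast
qed

section \<open>Charts with uniform bounds\<close>

lemma metric_coefficient_has_derivative:
  assumes c: "c \<in> A" and p: "p \<in> cdom c"
  shows "((\<lambda>x. g c (cinv c x) u v) has_derivative (\<lambda>w. metric_deriv g c p w u v)) (at (cmap c p))"
proof -
  have "(\<lambda>x. g c (cinv c x) u v) differentiable (at (cmap c p))"
    using Ck_metric[OF c, of 1 u v] p by auto
  then show ?thesis unfolding metric_deriv_def by (simp add: frechet_derivative_works)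
qed

lemma metric_deriv_expand:
  assumes c: "c \<in> A" and p: "p \<in> cdom c"
  shows "metric_deriv g c p w u v =
    (\<Sum>k\<in>Basis. \<Sum>i\<in>Basis. \<Sum>j\<in>Basis. (w \<bullet> k) * (u \<bullet> i) * (v \<bullet> j) * metric_deriv g c p k i j)"
proof -
  have lin: "linear (\<lambda>w. metric_deriv g c p w u v)" for u v
    using metric_coefficient_has_derivative[OF c p] has_derivative_linear by blast
  have "((\<lambda>x. \<Sum>i\<in>Basis. \<Sum>j\<in>Basis. (u \<bullet> i) * (v \<bullet> j) * g c (cinv c x) i j) has_derivative
      (\<lambda>w. \<Sum>i\<in>Basis. \<Sum>j\<in>Basis. (u \<bullet> i) * (v \<bullet> j) * metric_deriv g c p w i j)) (at (cmap c p))"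
    by (intro has_derivative_sum has_derivative_mult_right metric_coefficient_has_derivative c p)
  then have "((\<lambda>x. g c (cinv c x) u v) has_derivative
      (\<lambda>w. \<Sum>i\<in>Basis. \<Sum>j\<in>Basis. (u \<bullet> i) * (v \<bullet> j) * metric_deriv g c p w i j)) (at (cmap c p))"
    by (rule has_derivative_transform_within_open[OF _ open_chart_image[OF c]])
      (use p in \<open>auto intro!: metric_expand[symmetric] c cinv_in_domain\<close>)
  from has_derivative_unique[OF this metric_coefficient_has_derivative[OF c p]]
  have 1: "metric_deriv g c p w u v =
      (\<Sum>i\<in>Basis. \<Sum>j\<in>Basis. (u \<bullet> i) * (v \<bullet> j) * metric_deriv g c p w i j)" for w
    by metis
  have "metric_deriv g c p w u v = metric_deriv g c p (\<Sum>k\<in>Basis. (w \<bullet> k) *\<^sub>R k) u v"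
    by (simp add: euclidean_representation)
  also have "\<dots> = (\<Sum>k\<in>Basis. (w \<bullet> k) * metric_deriv g c p k u v)"
    by (simp add: linear_sum[OF lin] linear_scale[OF lin])
  also have "\<dots> = (\<Sum>k\<in>Basis. \<Sum>i\<in>Basis. \<Sum>j\<in>Basis.
      (w \<bullet> k) * (u \<bullet> i) * (v \<bullet> j) * metric_deriv g c p k i j)"
    by (subst 1) (simp add: sum_distrib_left ac_simps)
  finally show ?thesis .
qed

lemma metric_deriv_bounded_compact:
  assumes c: "c \<in> A" and K: "compact K" "K \<subseteq> cmap c ` cdom c"
  obtains \<beta> where "\<beta> \<ge> 0"
    "\<And>z w u v. z \<in> K \<Longrightarrow> \<bar>metric_deriv g c (cinv c z) w u v\<bar> \<le> \<beta> * norm w * norm u * norm v"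
proof -
  define S where "S z = (\<Sum>k\<in>Basis. \<Sum>i\<in>Basis. \<Sum>j\<in>Basis. \<bar>metric_deriv g c (cinv c z) k i j\<bar>)" for z
  have "continuous_on K (\<lambda>z. metric_deriv g c (cinv c z) k i j)" for k i j
  proof -
    have "continuous_on (cmap c ` cdom c) (\<lambda>z. frechet_derivative (\<lambda>x. g c (cinv c x) i j) (at z) k)"
      using Ck_metric[OF c, of 1 i j] by simp
    then have "continuous_on K (\<lambda>z. frechet_derivative (\<lambda>x. g c (cinv c x) i j) (at z) k)"
      using K(2) continuous_on_subset by blast
    then show ?thesis
      using K(2) cmap_cinv[of _ c] by (subst continuous_on_cong[OF refl]) (auto simp: metric_deriv_def)
  qed
  then have "continuous_on K S" unfolding S_def by (intro continuous_intros)
  then have "bounded (S ` K)" using K(1) by (simp add: compact_continuous_image compact_imp_bounded)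
  then obtain \<beta> where b: "\<beta> > 0" "\<And>z. z \<in> K \<Longrightarrow> \<bar>S z\<bar> \<le> \<beta>"
    unfolding bounded_pos by auto
  have "\<bar>metric_deriv g c (cinv c z) w u v\<bar> \<le> \<beta> * norm w * norm u * norm v" if z: "z \<in> K" for z w u v
  proof -
    have p: "cinv c z \<in> cdom c" using z K(2) by (blast intro: cinv_in_domain)
    \<comment> \<open>By trilinearity it suffices to bound the finitely many values on basis vectors.\<close>
    have "\<bar>metric_deriv g c (cinv c z) w u v\<bar> \<le>
      (\<Sum>k\<in>Basis. \<Sum>i\<in>Basis. \<Sum>j\<in>Basis. \<bar>(w \<bullet> k) * (u \<bullet> i) * (v \<bullet> j) * metric_deriv g c (cinv c z) k i j\<bar>)"
      by (subst metric_deriv_expand[OF c p]) (intro order_trans[OF sum_abs] sum_mono order_refl)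
    also have "\<dots> \<le> (\<Sum>k\<in>Basis. \<Sum>i\<in>Basis. \<Sum>j\<in>Basis.
        (norm w * norm u * norm v) * \<bar>metric_deriv g c (cinv c z) k i j\<bar>)"
      by (intro sum_mono) (simp add: abs_mult mult_mono mult_nonneg_nonneg Basis_le_norm)
    also have "\<dots> = (norm w * norm u * norm v) * S z" by (simp add: S_def sum_distrib_left)
    also have "\<dots> \<le> (norm w * norm u * norm v) * \<beta>"
      using b(2)[OF z] by (intro mult_left_mono) auto
    finally show ?thesis by (simp add: ac_simps)
  qed
  then show ?thesis using that[of \<beta>] b(1) by simp
qed

lemma christoffel_koszul:
  assumes c: "c \<in> A" and p: "p \<in> cdom c"
  shows "2 * g c p (christoffel g c p u v) w =
    metric_deriv g c p u v w + metric_deriv g c p v u w - metric_deriv g c p w u v"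
proof -
  have b: "bilinear (g c p)" using metric_bilinear c p by blast
  interpret L: linear "\<lambda>x. g c p x y" for y using b by (simp add: bilinear_def)
  interpret R: linear "\<lambda>y. g c p x y" for x using b by (simp add: bilinear_def)
  have b2: "bilinear (\<lambda>z w. 2 * g c p z w)"
    unfolding bilinear_def
    by (auto intro!: linearI simp: L.add L.scale R.add R.scale algebra_simps)
  have lin3: "linear (\<lambda>w. metric_deriv g c p w u v)" for u v
    using metric_coefficient_has_derivative[OF c p] has_derivative_linear by blast
  have lin2: "linear (\<lambda>w. metric_deriv g c p u v w)" for u v
    by (rule linearI)
      (simp_all add: metric_deriv_expand[OF c p, of u v] inner_add_left algebra_simps sum.distrib sum_distrib_left)
  have "linear (\<lambda>w. metric_deriv g c p u v w + metric_deriv g c p v u w - metric_deriv g c p w u v)"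
    by (intro linear_compose_add linear_compose_sub lin2 lin3)
  from positive_definite_representation[OF b2 _ this] metric_pos[OF c p]
  have "\<exists>!z. \<forall>w. 2 * g c p z w =
    metric_deriv g c p u v w + metric_deriv g c p v u w - metric_deriv g c p w u v"
    by simp
  from theI'[OF this] show ?thesis unfolding christoffel_def by blast
qed

text \<open>
  One constant for all comparisons at \<open>p\<close>, so that finitely many such constants can be merged by taking
  their maximum.
\<close>

definition chart_bounds :: "real \<Rightarrow> ('a, 'e) chart \<Rightarrow> 'a \<Rightarrow> bool" where
  "chart_bounds \<kappa> c p \<longleftrightarrow> (\<forall>u v. norm v \<le> \<kappa> * tnorm g c p v \<and> tnorm g c p v \<le> \<kappa> * norm v \<and>
     norm (christoffel g c p u v) \<le> \<kappa> * norm u * norm v)"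

lemma chart_bounds_mono:
  assumes "chart_bounds \<kappa> c p" "\<kappa> \<le> \<kappa>'" "c \<in> A" "p \<in> cdom c"
  shows "chart_bounds \<kappa>' c p"
  unfolding chart_bounds_def
proof (intro allI conjI)
  fix u v :: 'e
  have "\<kappa> * tnorm g c p v \<le> \<kappa>' * tnorm g c p v" "\<kappa> * norm v \<le> \<kappa>' * norm v"
     "\<kappa> * norm u * norm v \<le> \<kappa>' * norm u * norm v"
    using assms(2) tnorm_nonneg[OF assms(3,4)] by (simp_all add: mult_right_mono)
  then show "norm v \<le> \<kappa>' * tnorm g c p v" "tnorm g c p v \<le> \<kappa>' * norm v"
     "norm (christoffel g c p u v) \<le> \<kappa>' * norm u * norm v"
    using assms(1) unfolding chart_bounds_def by (meson order_trans)+
qed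

lemma chart_bounds_compact:
  assumes c: "c \<in> A" and K: "compact K" "K \<subseteq> cmap c ` cdom c"
  obtains \<kappa> where "\<And>z. z \<in> K \<Longrightarrow> chart_bounds \<kappa> c (cinv c z)"
proof -
  obtain k where k: "k > 0"
    "\<And>z v. z \<in> K \<Longrightarrow> norm v \<le> k * tnorm g c (cinv c z) v"
    "\<And>z v. z \<in> K \<Longrightarrow> tnorm g c (cinv c z) v \<le> k * norm v"
    using norm_tnorm_bounds_compact[OF c K] by blast
  obtain \<beta> where b: "\<beta> \<ge> 0"
    "\<And>z w u v. z \<in> K \<Longrightarrow> \<bar>metric_deriv g c (cinv c z) w u v\<bar> \<le> \<beta> * norm w * norm u * norm v"
    using metric_deriv_bounded_compact[OF c K] by blast
  have chr: "norm (christoffel g c (cinv c z) u v) \<le> (k\<^sup>2 * (2 * \<beta>)) * norm u * norm v"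
    if z: "z \<in> K" for z u v
  proof -
    define y where "y = christoffel g c (cinv c z) u v"
    have p: "cinv c z \<in> cdom c" using z K(2) by (blast intro: cinv_in_domain)
    \<comment> \<open>Testing Koszul's formula with the Christoffel vector \<open>y\<close> itself bounds \<open>g y y\<close> by a multiple of
      \<open>norm y\<close>; then one factor \<open>norm y\<close> cancels.\<close>
    have "(norm y)\<^sup>2 \<le> (k * tnorm g c (cinv c z) y)\<^sup>2" using k(2)[OF z] by (simp add: power_mono)
    also have "\<dots> = k\<^sup>2 * g c (cinv c z) y y"
      by (simp add: power_mult_distrib tnorm_def metric_nonneg[OF c p])
    also have "\<dots> \<le> k\<^sup>2 * (2 * \<beta> * norm u * norm v * norm y)"
    proof (intro mult_left_mono)
      have "2 * g c (cinv c z) y y \<le> 3 * (\<beta> * norm u * norm v * norm y)"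
        using b(2)[OF z, of u v y] b(2)[OF z, of v u y] b(2)[OF z, of y u v]
          christoffel_koszul[OF c p, of u v y]
        by (simp add: y_def[symmetric] ac_simps)
      moreover have "0 \<le> \<beta> * norm u * norm v * norm y" using b(1) by simp
      ultimately show "g c (cinv c z) y y \<le> 2 * \<beta> * norm u * norm v * norm y" by simp
    qed simp
    also have "\<dots> = (k\<^sup>2 * (2 * \<beta>) * norm u * norm v) * norm y" by simp
    finally have "norm y * norm y \<le> (k\<^sup>2 * (2 * \<beta>) * norm u * norm v) * norm y"
      by (simp add: power2_eq_square)
    moreover have "0 \<le> k\<^sup>2 * (2 * \<beta>) * norm u * norm v" using b(1) by simp
    ultimately show ?thesis
      unfolding y_def[symmetric]
      by (metis linorder_not_less mult_right_le_imp_le norm_ge_zero order_le_less)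
  qed
  define m where "m = max k (k\<^sup>2 * (2 * \<beta>))"
  have "chart_bounds m c (cinv c z)" if z: "z \<in> K" for z
    unfolding chart_bounds_def
  proof (intro allI conjI)
    fix u v :: 'e
    have p: "cinv c z \<in> cdom c" using z K(2) by (blast intro: cinv_in_domain)
    have "k * tnorm g c (cinv c z) v \<le> m * tnorm g c (cinv c z) v" "k * norm v \<le> m * norm v"
       "(k\<^sup>2 * (2 * \<beta>)) * norm u * norm v \<le> m * norm u * norm v"
      using tnorm_nonneg[OF c p] by (auto intro!: mult_right_mono simp: m_def)
    then show "norm v \<le> m * tnorm g c (cinv c z) v" "tnorm g c (cinv c z) v \<le> m * norm v"
       "norm (christoffel g c (cinv c z) u v) \<le> m * norm u * norm v"
      using k(2,3)[OF z] chr[OF z] by (meson order_trans)+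
  qed
  then show ?thesis using that by blast
qed

text \<open>
  The same constant also measures, through its inverse, the radius of a coordinate ball around \<open>x\<close>. All
  conditions become weaker when \<open>\<kappa>\<close> grows.
\<close>

definition controlled_chart :: "real \<Rightarrow> ('a, 'e) chart \<Rightarrow> 'a \<Rightarrow> bool" where
  "controlled_chart \<kappa> c x \<longleftrightarrow> 1 \<le> \<kappa> \<and> c \<in> A \<and> x \<in> cdom c \<and> cball (cmap c x) (1 / \<kappa>) \<subseteq> cmap c ` cdom c \<and>
     (\<forall>z\<in>cball (cmap c x) (1 / \<kappa>). chart_bounds \<kappa> c (cinv c z))"

lemma controlled_chart_mono:
  assumes "controlled_chart \<kappa> c x" "\<kappa> \<le> \<kappa>'"
  shows "controlled_chart \<kappa>' c x"
proof -
  have "1 / \<kappa>' \<le> 1 / \<kappa>" using assms by (auto simp: controlled_chart_def intro!: divide_left_mono)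
  then have "cball (cmap c x) (1 / \<kappa>') \<subseteq> cball (cmap c x) (1 / \<kappa>)" by (rule subset_cball)
  moreover have "chart_bounds \<kappa>' c (cinv c z)" if "z \<in> cball (cmap c x) (1 / \<kappa>)" for z
    using that assms chart_bounds_mono[of \<kappa> c _ \<kappa>', OF _ _ _ cinv_in_domain]
    unfolding controlled_chart_def by blast
  moreover have "1 \<le> \<kappa>'" using assms unfolding controlled_chart_def by linarith
  ultimately show ?thesis
    using assms unfolding controlled_chart_def by (meson order_trans subsetD)
qed

lemma controlled_chart_neighbourhood:
  assumes "x \<in> M"
  obtains \<kappa> c W where "openin (top_of_set M) W" "x \<in> W" "\<And>y. y \<in> W \<Longrightarrow> controlled_chart \<kappa> c y"
proof -
  obtain c where c: "c \<in> A" "x \<in> cdom c" using assms covering by blast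
  obtain r where r: "r > 0" "cball (cmap c x) r \<subseteq> cmap c ` cdom c"
    using open_chart_image[OF c(1)] c(2) open_contains_cball by blast
  obtain k where k: "\<And>z. z \<in> cball (cmap c x) r \<Longrightarrow> chart_bounds k c (cinv c z)"
    using chart_bounds_compact[OF c(1) compact_cball r(2)] by blast
  define \<kappa> where "\<kappa> = max 1 (max k (2 / r))"
  have \<kappa>: "1 \<le> \<kappa>" "k \<le> \<kappa>" "2 / r \<le> \<kappa>" by (auto simp: \<kappa>_def)
  have rk: "1 / \<kappa> \<le> r / 2" using \<kappa>(1,3) r(1) by (simp add: field_simps)
  define W where "W = cinv c ` ball (cmap c x) (r / 2)"
  have sub: "ball (cmap c x) (r / 2) \<subseteq> cball (cmap c x) r" using r(1) by auto
  have "openin (top_of_set M) W"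
    unfolding W_def using sub r(2) by (intro openin_cinv_image c) auto
  moreover have "x \<in> W"
    unfolding W_def using cinv_cmap[OF c] r(1) by (metis centre_in_ball half_gt_zero image_eqI)
  moreover have "controlled_chart \<kappa> c y" if y: "y \<in> W" for y
  proof -
    obtain z where z: "y = cinv c z" "z \<in> ball (cmap c x) (r / 2)" using y by (auto simp: W_def)
    have zV: "z \<in> cmap c ` cdom c" using z sub r(2) by blast
    then have yz: "cmap c y = z" "y \<in> cdom c"
      using z(1) cmap_cinv[OF zV] cinv_in_domain[OF zV] by simp_all
    have "dist z (cmap c x) + 1 / \<kappa> \<le> r" using z(2) rk by (simp add: dist_commute)
    then have sub2: "cball z (1 / \<kappa>) \<subseteq> cball (cmap c x) r" by (simp add: cball_subset_cball_iff)
    moreover have "chart_bounds \<kappa> c (cinv c w)" if "w \<in> cball z (1 / \<kappa>)" for w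
      using subsetD[OF sub2 that] subsetD[OF r(2) subsetD[OF sub2 that]]
      by (intro chart_bounds_mono[OF k \<kappa>(2) c(1) cinv_in_domain])
    ultimately show ?thesis
      unfolding controlled_chart_def yz(1) using \<kappa>(1) c(1) yz(2) r(2) by blast
  qed
  ultimately show ?thesis using that by blast
qed

text \<open>
  Every point has a neighbourhood on which a single chart and a single constant work; by compactness
  finitely many of these cover the manifold, and the largest constant serves everywhere.
\<close>

lemma uniformly_controlled_charts:
  assumes "compact M"
  obtains \<kappa> where "1 \<le> \<kappa>" "\<And>x. x \<in> M \<Longrightarrow> \<exists>c. controlled_chart \<kappa> c x"
proof -
  define \<W> where "\<W> = {W. openin (top_of_set M) W \<and> (\<exists>\<kappa> c. \<forall>y\<in>W. controlled_chart \<kappa> c y)}"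
  have "M \<subseteq> \<Union>\<W>"
  proof
    fix x assume "x \<in> M"
    then show "x \<in> \<Union>\<W>"
      by (elim controlled_chart_neighbourhood) (unfold \<W>_def, blast)
  qed
  moreover have "\<forall>W\<in>\<W>. openin (top_of_set M) W" by (auto simp: \<W>_def)
  ultimately obtain \<F> where F: "\<F> \<subseteq> \<W>" "finite \<F>" "M \<subseteq> \<Union>\<F>"
    using assms unfolding compact_eq_openin_cover by meson
  have "\<forall>W\<in>\<F>. \<exists>\<kappa> c. \<forall>y\<in>W. controlled_chart \<kappa> c y" using F(1) by (auto simp: \<W>_def)
  then obtain k c where kc: "\<And>W y. W \<in> \<F> \<Longrightarrow> y \<in> W \<Longrightarrow> controlled_chart (k W) (c W) y"
    by metis
  define \<kappa> where "\<kappa> = Max (insert 1 (k ` \<F>))"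
  have "1 \<le> \<kappa>" "\<And>W. W \<in> \<F> \<Longrightarrow> k W \<le> \<kappa>" using F(2) by (auto simp: \<kappa>_def)
  then show ?thesis
    using F(3) kc controlled_chart_mono by (intro that[of \<kappa>]) blast+
qed

section \<open>Speed and length of curves\<close>

lemma loc_rep_has_derivative:
  assumes "c \<in> A" "Ck_on (Suc k) (cmap c ` {p \<in> cdom c. h p \<in> cdom c'}) (loc_rep c h c')"
    and "p \<in> cdom c" "h p \<in> cdom c'"
  shows "(loc_rep c h c' has_derivative tangent_map c h c' p) (at (cmap c p))"
proof -
  have "tangent_map c h c' p = frechet_derivative (loc_rep c h c') (at (cmap c p))"
    by (rule ext) (simp add: tangent_map_def)
  then show ?thesis
    using Ck_on_Suc_has_derivative[OF assms(2), of "cmap c p"] assms(3,4) by simp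
qed

lemma curve_eventually_in_chart:
  assumes "continuous_on S \<gamma>" "\<gamma> ` S \<subseteq> M" "\<tau> \<in> S" "c \<in> A" "\<gamma> \<tau> \<in> cdom c"
  shows "\<exists>U. open U \<and> \<tau> \<in> U \<and> S \<inter> U = {t \<in> S. \<gamma> t \<in> cdom c}"
proof -
  have "openin (top_of_set S) (S \<inter> \<gamma> -` cdom c)"
    using assms(1,2) openin_chart_domain[OF assms(4)]
    by (meson continuous_openin_preimage image_subset_iff_funcset)
  then obtain T where "open T" "S \<inter> \<gamma> -` cdom c = S \<inter> T" by (auto simp: openin_open)
  then show ?thesis using assms(3,5) by (intro exI[of _ T]) auto
qed

text \<open>
  The chain rule for a map \<open>h\<close> applied to a curve, in coordinates. With \<open>h = id\<close> it is the change of
  charts for velocities. The derivative is taken within \<open>S\<close> so that it also covers end points of intervals.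
\<close>

lemma curve_chart_change_derivative:
  assumes c: "c \<in> A" and C1: "Ck_on (Suc k) (cmap c ` {p \<in> cdom c. h p \<in> cdom c'}) (loc_rep c h c')"
    and \<gamma>: "continuous_on S \<gamma>" "\<gamma> ` S \<subseteq> M" and \<tau>: "\<tau> \<in> S" "\<gamma> \<tau> \<in> cdom c" "h (\<gamma> \<tau>) \<in> cdom c'"
    and v: "((cmap c \<circ> \<gamma>) has_vector_derivative v) (at \<tau> within S)"
  shows "((cmap c' \<circ> (h \<circ> \<gamma>)) has_vector_derivative tangent_map c h c' (\<gamma> \<tau>) v) (at \<tau> within S)"
proof -
  have "(loc_rep c h c' has_derivative tangent_map c h c' (\<gamma> \<tau>)) (at (cmap c (\<gamma> \<tau>)))"
    by (rule loc_rep_has_derivative[OF c C1 \<tau>(2,3)])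
  then have "(loc_rep c h c' has_derivative tangent_map c h c' (\<gamma> \<tau>))
      (at ((cmap c \<circ> \<gamma>) \<tau>) within (cmap c \<circ> \<gamma>) ` S)"
    by (simp add: has_derivative_at_withinI)
  from vector_derivative_diff_chain_within[OF v this]
  have 1: "((loc_rep c h c' \<circ> (cmap c \<circ> \<gamma>)) has_vector_derivative tangent_map c h c' (\<gamma> \<tau>) v)
     (at \<tau> within S)" .
  obtain T where T: "open T" "\<tau> \<in> T" "S \<inter> T = {t \<in> S. \<gamma> t \<in> cdom c}"
    using curve_eventually_in_chart[OF \<gamma> \<tau>(1) c \<tau>(2)] by blast
  have eq: "(loc_rep c h c' \<circ> (cmap c \<circ> \<gamma>)) t = (cmap c' \<circ> (h \<circ> \<gamma>)) t" if "t \<in> S" "t \<in> T" for t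
  proof -
    have "\<gamma> t \<in> cdom c" using that T(3) by blast
    then show ?thesis using cinv_cmap[OF c] by (simp add: loc_rep_def)
  qed
  obtain d where "d > 0" "ball \<tau> d \<subseteq> T" using T(1,2) openE by blast
  then show ?thesis
    using 1 \<tau>(1) eq
    by (intro has_vector_derivative_transform_within[OF 1 \<open>d > 0\<close> \<tau>(1)]) (auto simp: subset_iff dist_commute)
qed

lemma tnorm_velocity_chart_independent:
  assumes c: "c \<in> A" "c' \<in> A" and \<gamma>: "continuous_on {s..t} \<gamma>" "\<gamma> ` {s..t} \<subseteq> M"
    and \<tau>: "s < t" "\<tau> \<in> {s..t}" "\<gamma> \<tau> \<in> cdom c" "\<gamma> \<tau> \<in> cdom c'"
    and v: "((cmap c \<circ> \<gamma>) has_vector_derivative v) (at \<tau> within {s..t})"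
    and v': "((cmap c' \<circ> \<gamma>) has_vector_derivative v') (at \<tau> within {s..t})"
  shows "tnorm g c' (\<gamma> \<tau>) v' = tnorm g c (\<gamma> \<tau>) v"
proof -
  have "((cmap c' \<circ> (id \<circ> \<gamma>)) has_vector_derivative tangent_map c id c' (\<gamma> \<tau>) v) (at \<tau> within {s..t})"
    using \<tau>(4)
    by (intro curve_chart_change_derivative[OF c(1) smooth_transition[OF c, of "Suc 0"] \<gamma> \<tau>(2,3) _ v]) simp
  then have "v' = tangent_map c id c' (\<gamma> \<tau>) v"
    using v' vector_derivative_within_closed_interval[OF \<tau>(1,2)] by (metis id_comp)
  then show ?thesis
    unfolding tnorm_def using metric_transform[OF c, of "\<gamma> \<tau>" v v] \<tau>(3,4) by simp
qed

lemma C1_curve_velocity: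
  assumes "C1_curve A s t \<gamma>" "s < t" "c \<in> A"
  shows "continuous_on {\<tau> \<in> {s..t}. \<gamma> \<tau> \<in> cdom c} (\<lambda>\<tau>. vector_derivative (cmap c \<circ> \<gamma>) (at \<tau> within {s..t}))"
    and "\<And>\<tau>. \<tau> \<in> {s..t} \<Longrightarrow> \<gamma> \<tau> \<in> cdom c \<Longrightarrow>
      ((cmap c \<circ> \<gamma>) has_vector_derivative vector_derivative (cmap c \<circ> \<gamma>) (at \<tau> within {s..t}))
        (at \<tau> within {s..t})"
proof -
  obtain D where D: "continuous_on {\<tau> \<in> {s..t}. \<gamma> \<tau> \<in> cdom c} D"
    "\<And>\<tau>. \<tau> \<in> {s..t} \<Longrightarrow> \<gamma> \<tau> \<in> cdom c \<Longrightarrow> ((cmap c \<circ> \<gamma>) has_vector_derivative D \<tau>) (at \<tau> within {s..t})"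
    using assms(1,3) unfolding C1_curve_def Let_def by blast
  have eq: "vector_derivative (cmap c \<circ> \<gamma>) (at \<tau> within {s..t}) = D \<tau>"
    if "\<tau> \<in> {s..t}" "\<gamma> \<tau> \<in> cdom c" for \<tau>
    using vector_derivative_within_closed_interval[OF assms(2) that(1) D(2)[OF that]] .
  show "continuous_on {\<tau> \<in> {s..t}. \<gamma> \<tau> \<in> cdom c} (\<lambda>\<tau>. vector_derivative (cmap c \<circ> \<gamma>) (at \<tau> within {s..t}))"
    using D(1) by (rule continuous_on_eq) (simp add: eq)
  show "((cmap c \<circ> \<gamma>) has_vector_derivative vector_derivative (cmap c \<circ> \<gamma>) (at \<tau> within {s..t}))
        (at \<tau> within {s..t})"
    if "\<tau> \<in> {s..t}" "\<gamma> \<tau> \<in> cdom c" for \<tau>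
    using D(2)[OF that] eq[OF that] by simp
qed

text \<open>
  Unlike \<open>speed\<close>, this uses one-sided derivatives at \<open>s\<close> and \<open>t\<close>, which makes it continuous on the closed
  interval for a \<open>C\<^sup>1\<close> curve.
\<close>

definition one_sided_speed :: "real \<Rightarrow> real \<Rightarrow> (real \<Rightarrow> 'a) \<Rightarrow> real \<Rightarrow> real" where
  "one_sided_speed s t \<gamma> \<tau> =
     (let c = (SOME c. c \<in> A \<and> \<gamma> \<tau> \<in> cdom c)
      in tnorm g c (\<gamma> \<tau>) (vector_derivative (cmap c \<circ> \<gamma>) (at \<tau> within {s..t})))"

lemma some_chart:
  assumes "p \<in> M"
  shows "(SOME c. c \<in> A \<and> p \<in> cdom c) \<in> A" "p \<in> cdom (SOME c. c \<in> A \<and> p \<in> cdom c)"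
proof -
  have "\<exists>c. c \<in> A \<and> p \<in> cdom c" using assms covering by blast
  then have "(SOME c. c \<in> A \<and> p \<in> cdom c) \<in> A \<and> p \<in> cdom (SOME c. c \<in> A \<and> p \<in> cdom c)"
    by (rule someI_ex)
  then show "(SOME c. c \<in> A \<and> p \<in> cdom c) \<in> A" "p \<in> cdom (SOME c. c \<in> A \<and> p \<in> cdom c)" by auto
qed

lemma one_sided_speed_in_chart:
  assumes \<gamma>: "continuous_on {s..t} \<gamma>" "\<gamma> ` {s..t} \<subseteq> M" "C1_curve A s t \<gamma>" "s < t"
    and c: "c \<in> A" and \<tau>: "\<tau> \<in> {s..t}" "\<gamma> \<tau> \<in> cdom c"
  shows "one_sided_speed s t \<gamma> \<tau> = tnorm g c (\<gamma> \<tau>) (vector_derivative (cmap c \<circ> \<gamma>) (at \<tau> within {s..t}))"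
proof -
  have "\<gamma> \<tau> \<in> M" using \<gamma>(2) \<tau>(1) by blast
  note sc = some_chart[OF this]
  show ?thesis
    unfolding one_sided_speed_def Let_def
    by (rule tnorm_velocity_chart_independent[OF c sc(1) \<gamma>(1,2,4) \<tau>(1,2) sc(2)
          C1_curve_velocity(2)[OF \<gamma>(3,4) c \<tau>] C1_curve_velocity(2)[OF \<gamma>(3,4) sc(1) \<tau>(1) sc(2)]])
qed

text \<open>
  Continuity is a local matter and the speed does not depend on the chart, so near each time it can be
  computed in one fixed chart around the point of the curve.
\<close>

lemma continuous_one_sided_speed:
  assumes \<gamma>: "continuous_on {s..t} \<gamma>" "\<gamma> ` {s..t} \<subseteq> M" "C1_curve A s t \<gamma>" "s < t"
  shows "continuous_on {s..t} (one_sided_speed s t \<gamma>)"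
  unfolding continuous_on_eq_continuous_within
proof
  fix \<tau> assume \<tau>: "\<tau> \<in> {s..t}"
  then obtain c where c: "c \<in> A" "\<gamma> \<tau> \<in> cdom c" using \<gamma>(2) covering by blast
  define T where "T = {\<tau> \<in> {s..t}. \<gamma> \<tau> \<in> cdom c}"
  obtain U where U: "open U" "\<tau> \<in> U" "{s..t} \<inter> U = T"
    using curve_eventually_in_chart[OF \<gamma>(1,2) \<tau> c] unfolding T_def by blast
  have T_subset: "T \<subseteq> {s..t}" "\<gamma> ` T \<subseteq> cdom c" by (auto simp: T_def)
  have "continuous_on (cdom c) (cmap c)"
    using chart_homeomorphism[OF c(1)] by (simp add: homeomorphism_def)
  then have cont: "continuous_on T (\<lambda>\<tau>. cmap c (\<gamma> \<tau>))"
    using continuous_on_subset[OF \<gamma>(1) T_subset(1)] T_subset(2)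
    by (rule continuous_on_compose2)
  have "continuous_on T (\<lambda>\<tau>. tnorm g c (cinv c (cmap c (\<gamma> \<tau>)))
      (vector_derivative (cmap c \<circ> \<gamma>) (at \<tau> within {s..t})))"
    unfolding tnorm_def T_def
    using T_subset(2) C1_curve_velocity(1)[OF \<gamma>(3,4) c(1)] cont
    by (intro continuous_intros continuous_metric c) (auto simp: T_def)
  then have "continuous_on T (one_sided_speed s t \<gamma>)"
    by (rule continuous_on_eq)
      (simp add: T_def one_sided_speed_in_chart[OF \<gamma> c(1)] cinv_cmap[OF c(1)])
  then have "continuous (at \<tau> within T) (one_sided_speed s t \<gamma>)"
    using \<tau> c(2) by (simp add: continuous_on_eq_continuous_within T_def)
  moreover have "at \<tau> within T = at \<tau> within {s..t}"
    using U by (intro at_within_nhd[OF U(2,1)]) auto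
  ultimately show "continuous (at \<tau> within {s..t}) (one_sided_speed s t \<gamma>)" by simp
qed

lemma speed_eq_one_sided_speed: "s < \<tau> \<Longrightarrow> \<tau> < t \<Longrightarrow> speed A g \<gamma> \<tau> = one_sided_speed s t \<gamma> \<tau>"
  by (simp add: speed_def one_sided_speed_def at_within_Icc_at)

lemma speed_integrable_C1:
  assumes "continuous_on {s..t} \<gamma>" "\<gamma> ` {s..t} \<subseteq> M" "s < t \<Longrightarrow> C1_curve A s t \<gamma>"
  shows "speed A g \<gamma> integrable_on {s..t}"
proof (cases "s < t")
  case True
  have "one_sided_speed s t \<gamma> integrable_on {s..t}"
    using continuous_one_sided_speed[OF assms(1,2)] assms(3) True integrable_continuous_interval by blast
  then show ?thesis
    by (rule integrable_spike_finite[of "{s, t}", rotated 2]) (auto intro: speed_eq_one_sided_speed)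
next
  case False
  then have "negligible {s..t}" by (cases "s = t") simp_all
  then show ?thesis by (rule integrable_negligible)
qed

lemma piecewise_C1_curveD:
  assumes "piecewise_C1_curve M A a b \<gamma>"
  shows "continuous_on {a..b} \<gamma>" "\<gamma> ` {a..b} \<subseteq> M"
  using assms unfolding piecewise_C1_curve_def by blast+

lemma speed_integrable:
  assumes "piecewise_C1_curve M A a b \<gamma>"
  shows "speed A g \<gamma> integrable_on {a..b}"
proof -
  obtain B where \<gamma>: "continuous_on {a..b} \<gamma>" "\<gamma> ` {a..b} \<subseteq> M" and B: "finite B"
    "\<And>s t. a \<le> s \<Longrightarrow> s < t \<Longrightarrow> t \<le> b \<Longrightarrow> {s<..<t} \<inter> B = {} \<Longrightarrow> C1_curve A s t \<gamma>"
    using assms unfolding piecewise_C1_curve_def by blast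
  have int: "speed A g \<gamma> integrable_on {s..t}" if "a \<le> s" "t \<le> b" "{s<..<t} \<inter> B = {}" for s t
    using that B(2) \<gamma> by (intro speed_integrable_C1) (auto intro: continuous_on_subset)
  have "speed A g \<gamma> integrable_on cbox a b"
  proof (rule integrable_on_little_subintervals, intro ballI)
    fix x assume x: "x \<in> cbox a b"
    obtain d where d: "d > 0" "\<And>y. y \<in> B \<Longrightarrow> y \<noteq> x \<Longrightarrow> d \<le> dist x y"
      using finite_set_avoid[OF B(1), of x] by blast
    \<comment> \<open>Near \<open>x\<close> the only possible break point is \<open>x\<close> itself, so cutting at \<open>x\<close> yields two
      intervals without interior break points.\<close>
    show "\<exists>d>0. \<forall>u v. x \<in> cbox u v \<and> cbox u v \<subseteq> ball x d \<and> cbox u v \<subseteq> cbox a b \<longrightarrow>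
        speed A g \<gamma> integrable_on cbox u v"
    proof (intro exI conjI allI impI)
      show "d > 0" by (rule d)
      fix u v assume h: "x \<in> cbox u v \<and> cbox u v \<subseteq> ball x d \<and> cbox u v \<subseteq> cbox a b"
      then have uv: "u \<le> x" "x \<le> v" "a \<le> u" "v \<le> b" by auto
      have "y \<notin> B" if "y \<in> {u..v}" "y \<noteq> x" for y
      proof
        assume "y \<in> B"
        then have "d \<le> dist x y" using d(2) that(2) by blast
        moreover have "y \<in> ball x d" using h that(1) by (auto simp: subset_iff)
        ultimately show False by simp
      qed
      then have "speed A g \<gamma> integrable_on {u..x}" "speed A g \<gamma> integrable_on {x..v}"
        using uv by (auto intro!: int)
      then show "speed A g \<gamma> integrable_on cbox u v"
        using Henstock_Kurzweil_Integration.integrable_combine[OF uv(1,2)] by simp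
    qed
  qed
  then show ?thesis by simp
qed

lemma speed_nonneg: "\<gamma> \<tau> \<in> M \<Longrightarrow> 0 \<le> speed A g \<gamma> \<tau>"
  unfolding speed_def Let_def by (intro tnorm_nonneg some_chart)

lemma curve_length_nonneg:
  assumes "piecewise_C1_curve M A a b \<gamma>"
  shows "0 \<le> curve_length A g a b \<gamma>"
  unfolding curve_length_def
  by (rule integral_nonneg[OF speed_integrable[OF assms]])
     (use piecewise_C1_curveD(2)[OF assms] in \<open>auto intro!: speed_nonneg\<close>)

text \<open>
  At a time with a neighbourhood free of break points the one-sided and two-sided derivatives agree, so
  \<open>speed\<close>, which refers to an arbitrarily selected chart, can be computed in any chart.
\<close>

lemma piecewise_C1_curve_speed:
  assumes "piecewise_C1_curve M A a b \<gamma>"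
  obtains B where "finite B"
    "\<And>\<tau> c. \<tau> \<in> {a<..<b} - B \<Longrightarrow> c \<in> A \<Longrightarrow> \<gamma> \<tau> \<in> cdom c \<Longrightarrow>
      ((cmap c \<circ> \<gamma>) has_vector_derivative vector_derivative (cmap c \<circ> \<gamma>) (at \<tau>)) (at \<tau>) \<and>
      speed A g \<gamma> \<tau> = tnorm g c (\<gamma> \<tau>) (vector_derivative (cmap c \<circ> \<gamma>) (at \<tau>))"
proof -
  obtain B where \<gamma>: "continuous_on {a..b} \<gamma>" "\<gamma> ` {a..b} \<subseteq> M" and B: "finite B"
    "\<And>s t. a \<le> s \<Longrightarrow> s < t \<Longrightarrow> t \<le> b \<Longrightarrow> {s<..<t} \<inter> B = {} \<Longrightarrow> C1_curve A s t \<gamma>"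
    using assms unfolding piecewise_C1_curve_def by blast
  have "((cmap c \<circ> \<gamma>) has_vector_derivative vector_derivative (cmap c \<circ> \<gamma>) (at \<tau>)) (at \<tau>) \<and>
      speed A g \<gamma> \<tau> = tnorm g c (\<gamma> \<tau>) (vector_derivative (cmap c \<circ> \<gamma>) (at \<tau>))"
    if \<tau>: "\<tau> \<in> {a<..<b} - B" and c: "c \<in> A" "\<gamma> \<tau> \<in> cdom c" for \<tau> c
  proof -
    have "open ({a<..<b} - B)" using B(1) by (simp add: finite_imp_closed open_Diff)
    then obtain e where e: "e > 0" "cball \<tau> e \<subseteq> {a<..<b} - B"
      using \<tau> open_contains_cball by blast
    define s t where "s = \<tau> - e" and "t = \<tau> + e"
    have st: "s < \<tau>" "\<tau> < t" "{s..t} \<subseteq> {a<..<b} - B"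
      using e by (auto simp: s_def t_def cball_eq_atLeastAtMost)
    have "s \<in> {s..t}" "t \<in> {s..t}" using st by auto
    then have ab: "a \<le> s" "t \<le> b" using st(3) by (auto simp: subset_iff)
    have C1: "C1_curve A s t \<gamma>"
      using st ab by (intro B(2)) (auto simp: subset_iff)
    have sub: "continuous_on {s..t} \<gamma>" "\<gamma> ` {s..t} \<subseteq> M"
      using \<gamma> ab by (auto intro: continuous_on_subset)
    have *: "s < t" "\<tau> \<in> {s..t}" "at \<tau> within {s..t} = at \<tau>" using st by (auto simp: at_within_Icc_at)
    show ?thesis
      using C1_curve_velocity(2)[OF C1 *(1) c(1) *(2) c(2), unfolded *(3)]
        trans[OF speed_eq_one_sided_speed[OF st(1,2), of \<gamma>]
          one_sided_speed_in_chart[OF sub C1 *(1) c(1) *(2) c(2), unfolded *(3)]]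
      by (rule conjI)
  qed
  then show ?thesis using that B(1) by blast
qed

text \<open>
  As long as the curve stays in the ball, its coordinate displacement is at most \<open>\<kappa>\<close> times its length, by the
  fundamental theorem of calculus. A curve of length less than \<open>r / \<kappa>\<close> therefore never reaches the boundary.
\<close>

lemma short_curve_stays_in_chart_ball:
  assumes \<gamma>: "piecewise_C1_curve M A a b \<gamma>" and c: "c \<in> A" "\<gamma> a \<in> cdom c"
    and r: "r > 0" "ball (cmap c (\<gamma> a)) r \<subseteq> cmap c ` cdom c"
    and \<kappa>: "\<kappa> > 0" "\<And>z v. z \<in> ball (cmap c (\<gamma> a)) r \<Longrightarrow> norm v \<le> \<kappa> * tnorm g c (cinv c z) v"
    and len: "curve_length A g a b \<gamma> < r / \<kappa>"
    and t: "t \<in> {a..b}"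
  shows "\<gamma> t \<in> cinv c ` ball (cmap c (\<gamma> a)) r"
proof (rule ccontr)
  assume contr: "\<gamma> t \<notin> cinv c ` ball (cmap c (\<gamma> a)) r"
  define L where "L = curve_length A g a b \<gamma>"
  define W where "W = cinv c ` ball (cmap c (\<gamma> a)) r"
  define N where "N = {t \<in> {a..b}. \<gamma> t \<notin> W}"
  have cont: "continuous_on {a..b} \<gamma>" and inM: "\<gamma> ` {a..b} \<subseteq> M"
    using piecewise_C1_curveD[OF \<gamma>] by blast+
  have L: "0 \<le> L" "\<kappa> * L < r"
    using curve_length_nonneg[OF \<gamma>] len \<kappa>(1)
    by (simp_all add: L_def pos_less_divide_eq mult.commute)
  have W: "openin (top_of_set M) W" unfolding W_def using c(1) r(2) by (intro openin_cinv_image open_ball)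
  have W_dom: "W \<subseteq> cdom c" unfolding W_def using subsetD[OF r(2)] by (intro image_subsetI cinv_in_domain)
  have "openin (top_of_set {a..b}) ({a..b} \<inter> \<gamma> -` W)"
    using cont inM W by (meson continuous_openin_preimage image_subset_iff_funcset)
  then have "closedin (top_of_set {a..b}) ({a..b} - ({a..b} \<inter> \<gamma> -` W))"
    by (intro closedin_diff) auto
  moreover have "{a..b} - ({a..b} \<inter> \<gamma> -` W) = N" by (auto simp: N_def)
  ultimately have "closed N" using closedin_closed_trans[of "{a..b}" N] by simp
  moreover have "N \<noteq> {}" using contr t by (auto simp: N_def W_def)
  moreover have bdd: "bdd_below N" by (rule bdd_belowI[of _ a]) (auto simp: N_def)
  ultimately have first: "Inf N \<in> N" by (rule closed_contains_Inf[rotated 2])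
  \<comment> \<open>\<open>T\<close> is the first exit time from \<open>W\<close>. Before \<open>T\<close> the curve remains in the compact set \<open>K\<close> defined
    below, which lies inside \<open>W\<close>; by continuity so does the point at time \<open>T\<close>, a contradiction.\<close>
  define T where "T = Inf N"
  have T: "T \<in> {a..b}" "\<gamma> T \<notin> W" using first by (auto simp: N_def T_def)
  have before: "\<gamma> s \<in> W" if "a \<le> s" "s < T" for s
  proof (rule ccontr)
    assume "\<gamma> s \<notin> W"
    then have "s \<in> N" using that T(1) by (auto simp: N_def)
    then show False using cInf_lower[OF _ bdd, of s] that by (simp add: T_def)
  qed
  have "\<gamma> a \<in> W"
    unfolding W_def using cinv_cmap[OF c] r(1) by (metis centre_in_ball image_eqI)
  then have "a < T" using T by (metis atLeastAtMost_iff order_le_less)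
  obtain B where B: "finite B"
    "\<And>\<tau> c. \<tau> \<in> {a<..<b} - B \<Longrightarrow> c \<in> A \<Longrightarrow> \<gamma> \<tau> \<in> cdom c \<Longrightarrow>
      ((cmap c \<circ> \<gamma>) has_vector_derivative vector_derivative (cmap c \<circ> \<gamma>) (at \<tau>)) (at \<tau>) \<and>
      speed A g \<gamma> \<tau> = tnorm g c (\<gamma> \<tau>) (vector_derivative (cmap c \<circ> \<gamma>) (at \<tau>))"
    using piecewise_C1_curve_speed[OF \<gamma>] by blast
  have close: "norm (cmap c (\<gamma> s) - cmap c (\<gamma> a)) \<le> \<kappa> * L" if s: "a \<le> s" "s < T" for s
  proof -
    \<comment> \<open>The value 0 at the exceptional times makes the pointwise estimate by the speed hold everywhere.\<close>
    define D where "D \<tau> = (if \<tau> \<in> B \<union> {a, b} then 0 else vector_derivative (cmap c \<circ> \<gamma>) (at \<tau>))" for \<tau>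
    have inW: "\<gamma> \<tau> \<in> W" if "\<tau> \<in> {a..s}" for \<tau> using before that s by auto
    have "continuous_on {a..s} (cmap c \<circ> \<gamma>)"
    proof (rule continuous_on_compose)
      show "continuous_on {a..s} \<gamma>" using cont s T(1) by (auto intro: continuous_on_subset)
      have "continuous_on (cdom c) (cmap c)"
        using chart_homeomorphism[OF c(1)] by (simp add: homeomorphism_def)
      then show "continuous_on (\<gamma> ` {a..s}) (cmap c)"
        by (rule continuous_on_subset) (intro image_subsetI subsetD[OF W_dom] inW)
    qed
    then have D: "(D has_integral ((cmap c \<circ> \<gamma>) s - (cmap c \<circ> \<gamma>) a)) {a..s}"
    proof (rule fundamental_theorem_of_calculus_interior_strong[OF B(1) s(1), rotated])
      fix \<tau> assume \<tau>: "\<tau> \<in> {a<..<s} - B"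
      then have "\<gamma> \<tau> \<in> cdom c" "\<tau> \<in> {a<..<b} - B" using inW W_dom s T(1) by auto
      with B(2)[OF _ c(1)] \<tau> show "((cmap c \<circ> \<gamma>) has_vector_derivative D \<tau>) (at \<tau>)"
        by (auto simp: D_def)
    qed
    have le: "norm (D \<tau>) \<le> \<kappa> * speed A g \<gamma> \<tau>" if \<tau>: "\<tau> \<in> {a..s}" for \<tau>
    proof (cases "\<tau> \<in> B \<union> {a, b}")
      case True
      have "\<gamma> \<tau> \<in> M" using \<tau> inM s T(1) by auto
      then have "0 \<le> \<kappa> * speed A g \<gamma> \<tau>" using speed_nonneg[of \<gamma> \<tau>] \<kappa>(1) by simp
      then show ?thesis using True by (simp add: D_def)
    next
      case False
      then have \<tau>': "\<tau> \<in> {a<..<b} - B" using \<tau> s T(1) by auto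
      have "\<gamma> \<tau> \<in> W" using inW \<tau> by blast
      then obtain z where z: "\<gamma> \<tau> = cinv c z" "z \<in> ball (cmap c (\<gamma> a)) r" by (auto simp: W_def)
      have "\<gamma> \<tau> \<in> cdom c" using \<open>\<gamma> \<tau> \<in> W\<close> W_dom by blast
      then show ?thesis
        using B(2)[OF \<tau>' c(1)] \<kappa>(2)[OF z(2), of "D \<tau>"] False by (simp add: z(1) D_def)
    qed
    have int: "speed A g \<gamma> integrable_on {a..s}"
      using speed_integrable[OF \<gamma>] s T(1) by (auto intro: integrable_on_subinterval)
    have "norm (integral {a..s} D) \<le> integral {a..s} (\<lambda>\<tau>. \<kappa> * speed A g \<gamma> \<tau>)"
      using D int le by (intro Henstock_Kurzweil_Integration.integral_norm_bound_integral)
        (auto intro: integrable_on_mult_right)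
    also have "\<dots> = \<kappa> * integral {a..s} (speed A g \<gamma>)" by simp
    also have "\<dots> \<le> \<kappa> * L"
      unfolding L_def curve_length_def
      using \<kappa>(1) int speed_integrable[OF \<gamma>] s T(1) inM
      by (intro mult_left_mono integral_subset_le) (auto intro: speed_nonneg)
    finally show ?thesis using integral_unique[OF D] by simp
  qed
  define K where "K = cinv c ` cball (cmap c (\<gamma> a)) (\<kappa> * L)"
  have KV: "cball (cmap c (\<gamma> a)) (\<kappa> * L) \<subseteq> ball (cmap c (\<gamma> a)) r" using L by auto
  have "continuous_on (cmap c ` cdom c) (cinv c)"
    using chart_homeomorphism[OF c(1)] by (simp add: homeomorphism_def)
  then have "continuous_on (cball (cmap c (\<gamma> a)) (\<kappa> * L)) (cinv c)"
    by (rule continuous_on_subset) (use KV r(2) in blast)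
  then have "closed K" unfolding K_def by (intro compact_imp_closed compact_continuous_image) auto
  have "K \<subseteq> W" unfolding K_def W_def using KV by blast
  have inK: "\<gamma> s \<in> K" if "s \<in> {a..<T}" for s
  proof -
    have "\<gamma> s \<in> cdom c" using before that W_dom by auto
    then have "cinv c (cmap c (\<gamma> s)) = \<gamma> s" by (rule cinv_cmap[OF c(1)])
    moreover have "cmap c (\<gamma> s) \<in> cball (cmap c (\<gamma> a)) (\<kappa> * L)"
      using close[of s] that by (simp add: dist_norm norm_minus_commute)
    ultimately show ?thesis unfolding K_def by force
  qed
  have "closed ({a..b} \<inter> \<gamma> -` K)"
    using cont \<open>closed K\<close> continuous_closed_preimage[of "{a..b}" \<gamma> K] by simp
  moreover have "{a..<T} \<subseteq> {a..b} \<inter> \<gamma> -` K" using inK T(1) by auto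
  ultimately have "closure {a..<T} \<subseteq> {a..b} \<inter> \<gamma> -` K" by (rule closure_minimal[rotated])
  then have "\<gamma> T \<in> K" using \<open>a < T\<close> by (auto simp: closure_atLeastLessThan subset_iff)
  then show False using \<open>K \<subseteq> W\<close> T(2) by blast
qed

section \<open>Curves written in a chart\<close>

text \<open>
  A Euclidean \<open>C\<^sup>1\<close> curve in a chart, mapped to the manifold by \<open>h \<circ> cinv c\<close>, is \<open>C\<^sup>1\<close> in every chart, since its
  expression in the chart \<open>c'\<close> is \<open>loc_rep c h c'\<close> composed with the given curve. The case \<open>h = id\<close> produces
  curves in the manifold; other \<open>h\<close> produce their images.
\<close>

lemma C1_curve_from_chart:
  assumes c: "c \<in> A"
    and C1: "\<And>c'. c' \<in> A \<Longrightarrow> Ck_on (Suc k) (cmap c ` {p \<in> cdom c. h p \<in> cdom c'}) (loc_rep c h c')"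
    and \<psi>: "\<psi> ` {s..t} \<subseteq> cmap c ` cdom c"
    and D: "\<And>\<tau>. \<tau> \<in> {s..t} \<Longrightarrow> (\<psi> has_vector_derivative D \<tau>) (at \<tau> within {s..t})" "continuous_on {s..t} D"
  shows "C1_curve A s t (\<lambda>\<tau>. h (cinv c (\<psi> \<tau>)))"
  unfolding C1_curve_def Let_def
proof (intro ballI exI conjI)
  fix c' assume c': "c' \<in> A"
  define T where "T = {\<tau> \<in> {s..t}. h (cinv c (\<psi> \<tau>)) \<in> cdom c'}"
  define S where "S = cmap c ` {p \<in> cdom c. h p \<in> cdom c'}"
  define F where "F = loc_rep c h c'"
  have F: "Ck_on (Suc k) S F" using C1[OF c'] by (simp add: S_def F_def)
  have inS: "\<psi> \<tau> \<in> S" if "\<tau> \<in> T" for \<tau>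
  proof -
    have "\<psi> \<tau> \<in> cmap c ` cdom c" "h (cinv c (\<psi> \<tau>)) \<in> cdom c'" using that \<psi> by (auto simp: T_def)
    then show ?thesis
      unfolding S_def by (intro image_eqI[of _ _ "cinv c (\<psi> \<tau>)"]) (simp_all add: cmap_cinv inv_into_into)
  qed
  have "continuous_on {s..t} \<psi>"
    using D(1) has_vector_derivative_continuous unfolding continuous_on_eq_continuous_within by blast
  then have cont: "continuous_on T \<psi>" "continuous_on T D"
    using D(2) by (auto simp: T_def intro: continuous_on_subset)
  show "continuous_on T (\<lambda>\<tau>. frechet_derivative F (at (\<psi> \<tau>)) (D \<tau>))"
    by (rule Ck_on_continuous_derivative[OF F cont(1) _ cont(2)]) (use inS in blast)
  fix \<tau> assume \<tau>: "\<tau> \<in> T"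
  then have \<tau>': "\<tau> \<in> {s..t}" by (simp add: T_def)
  have "(F has_derivative frechet_derivative F (at (\<psi> \<tau>))) (at (\<psi> \<tau>) within \<psi> ` {s..t})"
    using Ck_on_Suc_has_derivative[OF F inS[OF \<tau>]] by (rule has_derivative_at_withinI)
  from vector_derivative_diff_chain_within[OF D(1)[OF \<tau>'] this]
  have "((F \<circ> \<psi>) has_vector_derivative frechet_derivative F (at (\<psi> \<tau>)) (D \<tau>)) (at \<tau> within {s..t})" .
  moreover have "F \<circ> \<psi> = cmap c' \<circ> (\<lambda>\<tau>. h (cinv c (\<psi> \<tau>)))" by (simp add: F_def loc_rep_def fun_eq_iff)
  ultimately show "((cmap c' \<circ> (\<lambda>\<tau>. h (cinv c (\<psi> \<tau>)))) has_vector_derivative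
      frechet_derivative F (at (\<psi> \<tau>)) (D \<tau>)) (at \<tau> within {s..t})" by simp
qed

lemma segment_image_curve:
  assumes c: "c \<in> A"
    and C1: "\<And>c'. c' \<in> A \<Longrightarrow> Ck_on (Suc k) (cmap c ` {p \<in> cdom c. h p \<in> cdom c'}) (loc_rep c h c')"
    and h: "continuous_on M h" "h ` M \<subseteq> M"
    and seg: "closed_segment z w \<subseteq> cmap c ` cdom c"
  shows "piecewise_C1_curve M A 0 1 (\<lambda>\<tau>. h (cinv c (z + \<tau> *\<^sub>R (w - z))))"
  unfolding piecewise_C1_curve_def
proof (intro conjI exI[of _ "{}"] allI impI)
  have inV: "z + \<tau> *\<^sub>R (w - z) \<in> cmap c ` cdom c" if "\<tau> \<in> {0..1}" for \<tau>
  proof -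
    have "z + \<tau> *\<^sub>R (w - z) \<in> closed_segment z w"
      using that by (auto simp: in_segment algebra_simps intro!: exI[of _ \<tau>])
    then show ?thesis using seg by blast
  qed
  have "continuous_on (cmap c ` cdom c) (cinv c)"
    using chart_homeomorphism[OF c] by (simp add: homeomorphism_def)
  then have "continuous_on {0..1} (\<lambda>\<tau>. cinv c (z + \<tau> *\<^sub>R (w - z)))"
    by (rule continuous_on_compose2) (intro continuous_intros, use inV in blast)
  moreover have inM: "cinv c (z + \<tau> *\<^sub>R (w - z)) \<in> M" if "\<tau> \<in> {0..1}" for \<tau>
    using chart_domain_subset[OF c] cinv_in_domain[OF inV[OF that]] by blast
  ultimately show "continuous_on {0..1} (\<lambda>\<tau>. h (cinv c (z + \<tau> *\<^sub>R (w - z))))"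
    by (intro continuous_on_compose2[OF h(1)]) auto
  show "(\<lambda>\<tau>. h (cinv c (z + \<tau> *\<^sub>R (w - z)))) ` {0..1} \<subseteq> M"
    using inM h(2) by (auto simp: image_subset_iff)
  fix s t :: real assume st: "0 \<le> s \<and> s < t \<and> t \<le> 1 \<and> {s<..<t} \<inter> {} = {}"
  show "C1_curve A s t (\<lambda>\<tau>. h (cinv c (z + \<tau> *\<^sub>R (w - z))))"
  proof (rule C1_curve_from_chart[OF c C1])
    show "(\<lambda>\<tau>. z + \<tau> *\<^sub>R (w - z)) ` {s..t} \<subseteq> cmap c ` cdom c"
      using st by (intro image_subsetI inV) auto
    show "((\<lambda>\<tau>. z + \<tau> *\<^sub>R (w - z)) has_vector_derivative w - z) (at \<tau> within {s..t})" for \<tau>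
      by (auto intro!: derivative_eq_intros)
  qed auto
qed simp

lemma segment_image_length:
  assumes c: "c \<in> A"
    and C1: "\<And>c'. c' \<in> A \<Longrightarrow> Ck_on (Suc k) (cmap c ` {p \<in> cdom c. h p \<in> cdom c'}) (loc_rep c h c')"
    and h: "continuous_on M h" "h ` M \<subseteq> M"
    and seg: "closed_segment z w \<subseteq> cmap c ` cdom c"
    and L: "\<And>y c'. y \<in> closed_segment z w \<Longrightarrow> c' \<in> A \<Longrightarrow> h (cinv c y) \<in> cdom c' \<Longrightarrow>
       tnorm g c' (h (cinv c y)) (tangent_map c h c' (cinv c y) (w - z)) \<le> L"
  shows "curve_length A g 0 1 (\<lambda>\<tau>. h (cinv c (z + \<tau> *\<^sub>R (w - z)))) \<le> L"
proof -
  define \<sigma> where "\<sigma> = (\<lambda>\<tau>. h (cinv c (z + \<tau> *\<^sub>R (w - z))))"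
  have \<sigma>: "piecewise_C1_curve M A 0 1 \<sigma>"
    unfolding \<sigma>_def by (rule segment_image_curve[OF c C1 h seg])
  obtain B where B: "finite B"
    "\<And>\<tau> c. \<tau> \<in> {0<..<1} - B \<Longrightarrow> c \<in> A \<Longrightarrow> \<sigma> \<tau> \<in> cdom c \<Longrightarrow>
      ((cmap c \<circ> \<sigma>) has_vector_derivative vector_derivative (cmap c \<circ> \<sigma>) (at \<tau>)) (at \<tau>) \<and>
      speed A g \<sigma> \<tau> = tnorm g c (\<sigma> \<tau>) (vector_derivative (cmap c \<circ> \<sigma>) (at \<tau>))"
    using piecewise_C1_curve_speed[OF \<sigma>] by blast
  have "speed A g \<sigma> \<tau> \<le> L" if \<tau>: "\<tau> \<in> {0<..<1} - B" for \<tau>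
  proof -
    define y where "y = z + \<tau> *\<^sub>R (w - z)"
    have y: "y \<in> closed_segment z w"
      using \<tau> by (auto simp: y_def in_segment algebra_simps intro!: exI[of _ \<tau>])
    have yV: "y \<in> cmap c ` cdom c" using y seg by blast
    have "\<sigma> \<tau> \<in> M" using piecewise_C1_curveD(2)[OF \<sigma>] \<tau> by auto
    then obtain c' where c': "c' \<in> A" "\<sigma> \<tau> \<in> cdom c'" using covering by blast
    have \<sigma>y: "\<sigma> \<tau> = h (cinv c y)" by (simp add: \<sigma>_def y_def)
    have "(loc_rep c h c' has_derivative tangent_map c h c' (cinv c y)) (at (cmap c (cinv c y)))"
      using c' \<sigma>y by (intro loc_rep_has_derivative[OF c C1] cinv_in_domain yV) auto
    then have "(loc_rep c h c' has_derivative tangent_map c h c' (cinv c y))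
       (at (z + \<tau> *\<^sub>R (w - z)) within range (\<lambda>\<tau>. z + \<tau> *\<^sub>R (w - z)))"
      unfolding cmap_cinv[OF yV] y_def[symmetric] by (rule has_derivative_at_withinI)
    moreover have "((\<lambda>\<tau>. z + \<tau> *\<^sub>R (w - z)) has_vector_derivative w - z) (at \<tau>)"
      by (auto intro!: derivative_eq_intros)
    ultimately have "((loc_rep c h c' \<circ> (\<lambda>\<tau>. z + \<tau> *\<^sub>R (w - z))) has_vector_derivative
        tangent_map c h c' (cinv c y) (w - z)) (at \<tau>)"
      by (rule vector_derivative_diff_chain_within[rotated])
    moreover have "loc_rep c h c' \<circ> (\<lambda>\<tau>. z + \<tau> *\<^sub>R (w - z)) = cmap c' \<circ> \<sigma>"
      by (simp add: loc_rep_def \<sigma>_def fun_eq_iff)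
    ultimately have "vector_derivative (cmap c' \<circ> \<sigma>) (at \<tau>) = tangent_map c h c' (cinv c y) (w - z)"
      by (simp add: vector_derivative_at)
    then show ?thesis using B(2)[OF \<tau> c'] L[OF y c'(1)] c'(2) \<sigma>y by simp
  qed
  then have "integral {0..1} (speed A g \<sigma>) \<le> integral {0..1} (\<lambda>_::real. L)"
    by (intro integral_mono_except_finite[OF speed_integrable[OF \<sigma>] _ B(1)]) auto
  then show ?thesis by (simp add: curve_length_def \<sigma>_def)
qed

lemma C1_curve_cong:
  assumes "C1_curve A s t \<gamma>" "\<And>\<tau>. \<tau> \<in> {s..t} \<Longrightarrow> \<gamma>' \<tau> = \<gamma> \<tau>"
  shows "C1_curve A s t \<gamma>'"
  unfolding C1_curve_def Let_def
proof
  fix c assume "c \<in> A"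
  then obtain D where D: "continuous_on {\<tau> \<in> {s..t}. \<gamma> \<tau> \<in> cdom c} D"
    "\<And>\<tau>. \<tau> \<in> {s..t} \<Longrightarrow> \<gamma> \<tau> \<in> cdom c \<Longrightarrow> ((cmap c \<circ> \<gamma>) has_vector_derivative D \<tau>) (at \<tau> within {s..t})"
    using assms(1) unfolding C1_curve_def Let_def by blast
  have T: "{\<tau> \<in> {s..t}. \<gamma>' \<tau> \<in> cdom c} = {\<tau> \<in> {s..t}. \<gamma> \<tau> \<in> cdom c}" using assms(2) by auto
  have "((cmap c \<circ> \<gamma>') has_vector_derivative D \<tau>) (at \<tau> within {s..t})"
    if "\<tau> \<in> {s..t}" "\<gamma> \<tau> \<in> cdom c" for \<tau>
    by (rule has_vector_derivative_transform[OF that(1) _ D(2)[OF that]]) (simp add: assms(2))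
  then show "\<exists>D. continuous_on {\<tau> \<in> {s..t}. \<gamma>' \<tau> \<in> cdom c} D \<and>
      (\<forall>\<tau>\<in>{\<tau> \<in> {s..t}. \<gamma>' \<tau> \<in> cdom c}. ((cmap c \<circ> \<gamma>') has_vector_derivative D \<tau>) (at \<tau> within {s..t}))"
    unfolding T using D(1) by blast
qed

lemma C1_curve_shift:
  assumes "C1_curve A (s - b) (t - b) \<gamma>"
  shows "C1_curve A s t (\<lambda>\<tau>. \<gamma> (\<tau> - b))"
  unfolding C1_curve_def Let_def
proof
  fix c assume "c \<in> A"
  then obtain D where D: "continuous_on {\<tau> \<in> {s - b..t - b}. \<gamma> \<tau> \<in> cdom c} D"
    "\<And>\<tau>. \<tau> \<in> {s - b..t - b} \<Longrightarrow> \<gamma> \<tau> \<in> cdom c \<Longrightarrow>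
      ((cmap c \<circ> \<gamma>) has_vector_derivative D \<tau>) (at \<tau> within {s - b..t - b})"
    using assms(1) unfolding C1_curve_def Let_def by blast
  have "continuous_on {\<tau> \<in> {s..t}. \<gamma> (\<tau> - b) \<in> cdom c} (\<lambda>\<tau>. D (\<tau> - b))"
    by (rule continuous_on_compose2[OF D(1)]) (auto intro!: continuous_intros)
  moreover have "((cmap c \<circ> (\<lambda>\<tau>. \<gamma> (\<tau> - b))) has_vector_derivative D (\<tau> - b)) (at \<tau> within {s..t})"
    if \<tau>: "\<tau> \<in> {s..t}" "\<gamma> (\<tau> - b) \<in> cdom c" for \<tau>
  proof -
    have 1: "((\<lambda>\<tau>. \<tau> - b) has_vector_derivative 1) (at \<tau> within {s..t})"
      by (auto intro!: derivative_eq_intros)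
    have im: "(\<lambda>\<tau>. \<tau> - b) ` {s..t} = {s - b..t - b}" by simp
    have 2: "((cmap c \<circ> \<gamma>) has_vector_derivative D (\<tau> - b)) (at (\<tau> - b) within (\<lambda>\<tau>. \<tau> - b) ` {s..t})"
      unfolding im using \<tau> by (intro D(2)) auto
    from vector_diff_chain_within[OF 1 2] show ?thesis by (simp add: o_def)
  qed
  ultimately show "\<exists>D. continuous_on {\<tau> \<in> {s..t}. \<gamma> (\<tau> - b) \<in> cdom c} D \<and>
      (\<forall>\<tau>\<in>{\<tau> \<in> {s..t}. \<gamma> (\<tau> - b) \<in> cdom c}.
        ((cmap c \<circ> (\<lambda>\<tau>. \<gamma> (\<tau> - b))) has_vector_derivative D \<tau>) (at \<tau> within {s..t}))"
    by blast
qed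

text \<open>
  The second curve is shifted in time and the junction \<open>b\<close> becomes a break point, so that every interval
  without interior break points lies on one side of \<open>b\<close>.
\<close>

lemma piecewise_C1_curve_join:
  assumes \<gamma>1: "piecewise_C1_curve M A a b \<gamma>1" and \<gamma>2: "piecewise_C1_curve M A 0 1 \<gamma>2"
    and "a \<le> b" "\<gamma>1 b = \<gamma>2 0"
  shows "piecewise_C1_curve M A a (b + 1) (\<lambda>\<tau>. if \<tau> \<le> b then \<gamma>1 \<tau> else \<gamma>2 (\<tau> - b))"
proof -
  define \<gamma> where "\<gamma> = (\<lambda>\<tau>. if \<tau> \<le> b then \<gamma>1 \<tau> else \<gamma>2 (\<tau> - b))"
  obtain B1 where B1: "finite B1"
    "\<And>s t. a \<le> s \<Longrightarrow> s < t \<Longrightarrow> t \<le> b \<Longrightarrow> {s<..<t} \<inter> B1 = {} \<Longrightarrow> C1_curve A s t \<gamma>1"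
    using \<gamma>1 unfolding piecewise_C1_curve_def by blast
  obtain B2 where B2: "finite B2"
    "\<And>s t. 0 \<le> s \<Longrightarrow> s < t \<Longrightarrow> t \<le> 1 \<Longrightarrow> {s<..<t} \<inter> B2 = {} \<Longrightarrow> C1_curve A s t \<gamma>2"
    using \<gamma>2 unfolding piecewise_C1_curve_def by blast
  note c1 = piecewise_C1_curveD[OF \<gamma>1] and c2 = piecewise_C1_curveD[OF \<gamma>2]
  have right: "\<gamma> \<tau> = \<gamma>2 (\<tau> - b)" if "b \<le> \<tau>" for \<tau> using that assms(4) by (auto simp: \<gamma>_def)
  have left: "\<gamma> \<tau> = \<gamma>1 \<tau>" if "\<tau> \<le> b" for \<tau> using that by (simp add: \<gamma>_def)
  have "continuous_on {a..b} \<gamma>" using c1(1) by (rule continuous_on_eq) (simp add: left)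
  moreover have "continuous_on {b..b + 1} (\<lambda>\<tau>. \<gamma>2 (\<tau> - b))"
    by (rule continuous_on_compose2[OF c2(1)]) (auto intro!: continuous_intros)
  then have "continuous_on {b..b + 1} \<gamma>" by (rule continuous_on_eq) (simp add: right)
  ultimately have "continuous_on ({a..b} \<union> {b..b + 1}) \<gamma>" by (intro continuous_on_closed_Un) auto
  moreover have "{a..b} \<union> {b..b + 1} = {a..b + 1}" using assms(3) by auto
  ultimately have "continuous_on {a..b + 1} \<gamma>" by simp
  moreover have "\<gamma> ` {a..b + 1} \<subseteq> M"
  proof (rule image_subsetI)
    fix \<tau> assume "\<tau> \<in> {a..b + 1}"
    then show "\<gamma> \<tau> \<in> M" using c1(2) c2(2) by (cases "\<tau> \<le> b") (auto simp: \<gamma>_def image_subset_iff)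
  qed
  moreover have "C1_curve A s t \<gamma>"
    if st: "a \<le> s \<and> s < t \<and> t \<le> b + 1 \<and> {s<..<t} \<inter> (insert b (B1 \<union> (\<lambda>x. x + b) ` B2)) = {}" for s t
  proof (cases "t \<le> b")
    case True
    then have "C1_curve A s t \<gamma>1" using st by (intro B1(2)) auto
    then show ?thesis by (rule C1_curve_cong) (use True in \<open>auto intro: left\<close>)
  next
    case False
    then have "b \<le> s" using st by fastforce
    have "x + b \<notin> {s<..<t}" if "x \<in> B2" for x using st that by blast
    then have "{s - b<..<t - b} \<inter> B2 = {}" by fastforce
    then have "C1_curve A (s - b) (t - b) \<gamma>2" using st \<open>b \<le> s\<close> by (intro B2(2)) auto
    then have "C1_curve A s t (\<lambda>\<tau>. \<gamma>2 (\<tau> - b))" by (rule C1_curve_shift)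
    then show ?thesis by (rule C1_curve_cong) (use \<open>b \<le> s\<close> in \<open>auto intro: right\<close>)
  qed
  moreover have "finite (insert b (B1 \<union> (\<lambda>x. x + b) ` B2))" using B1(1) B2(1) by simp
  ultimately show ?thesis unfolding piecewise_C1_curve_def \<gamma>_def[symmetric] by blast
qed

section \<open>Riemannian distance on a connected manifold\<close>

text \<open>
  The distance is an infimum of real numbers, which says nothing when no curve joins \<open>x\<close> to \<open>y\<close>. This
  relation serves to exclude that case.
\<close>

definition joined_by_curve :: "'a \<Rightarrow> 'a \<Rightarrow> bool" where
  "joined_by_curve x y \<longleftrightarrow> (\<exists>a b \<gamma>. a \<le> b \<and> piecewise_C1_curve M A a b \<gamma> \<and> \<gamma> a = x \<and> \<gamma> b = y)"

lemma joined_by_curve_refl: "x \<in> M \<Longrightarrow> joined_by_curve x x"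
  unfolding joined_by_curve_def piecewise_C1_curve_def
  by (intro exI[of _ 0] exI[of _ "\<lambda>_. x"]) auto

lemma joined_by_curve_extend:
  assumes x: "joined_by_curve x (cinv c z)" and c: "c \<in> A"
    and seg: "closed_segment z w \<subseteq> cmap c ` cdom c"
  shows "joined_by_curve x (cinv c w)"
proof -
  obtain a b \<gamma>1 where g1: "a \<le> b" "piecewise_C1_curve M A a b \<gamma>1" "\<gamma>1 a = x" "\<gamma>1 b = cinv c z"
    using x unfolding joined_by_curve_def by blast
  define \<gamma>2 where "\<gamma>2 = (\<lambda>\<tau>. id (cinv c (z + \<tau> *\<^sub>R (w - z))))"
  have g2: "piecewise_C1_curve M A 0 1 \<gamma>2"
    unfolding \<gamma>2_def
    by (rule segment_image_curve[OF c smooth_transition[OF c, of _ "Suc 0"] _ _ seg]) auto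
  have "\<gamma>1 b = \<gamma>2 0" by (simp add: g1(4) \<gamma>2_def)
  from piecewise_C1_curve_join[OF g1(2) g2 g1(1) this]
  show ?thesis
    unfolding joined_by_curve_def using g1(1,3)
    by (intro exI[of _ a] exI[of _ "b + 1"] exI[of _ "\<lambda>\<tau>. if \<tau> \<le> b then \<gamma>1 \<tau> else \<gamma>2 (\<tau> - b)"])
      (simp add: \<gamma>2_def)
qed

lemma joined_by_curve_neighbourhood:
  assumes "y \<in> M"
  obtains W where "openin (top_of_set M) W" "y \<in> W"
    "\<And>x u v. u \<in> W \<Longrightarrow> v \<in> W \<Longrightarrow> joined_by_curve x u \<Longrightarrow> joined_by_curve x v"
proof -
  obtain c where c: "c \<in> A" "y \<in> cdom c" using assms covering by blast
  obtain r where r: "r > 0" "ball (cmap c y) r \<subseteq> cmap c ` cdom c"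
    using open_chart_image[OF c(1)] c(2) open_contains_ball by blast
  define W where "W = cinv c ` ball (cmap c y) r"
  have "openin (top_of_set M) W"
    unfolding W_def using c(1) r(2) by (intro openin_cinv_image open_ball)
  moreover have "y \<in> W"
    unfolding W_def using cinv_cmap[OF c] r(1) by (metis centre_in_ball image_eqI)
  moreover have "joined_by_curve x v" if "u \<in> W" "v \<in> W" and xu: "joined_by_curve x u" for x u v
  proof -
    obtain z w where zw: "u = cinv c z" "v = cinv c w" "z \<in> ball (cmap c y) r" "w \<in> ball (cmap c y) r"
      using \<open>u \<in> W\<close> \<open>v \<in> W\<close> by (auto simp: W_def)
    have "closed_segment z w \<subseteq> cmap c ` cdom c"
      using closed_segment_subset[OF zw(3,4) convex_ball] r(2) by (rule order_trans)
    from joined_by_curve_extend[OF _ c(1) this] show ?thesis using xu unfolding zw(1,2) by simp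
  qed
  ultimately show ?thesis using that by blast
qed

text \<open>
  Within a coordinate ball any two points are joined by a coordinate segment, so being joined to \<open>x\<close> is
  a locally constant property.
\<close>

lemma connected_imp_joined_by_curve:
  assumes "connected M" "x \<in> M" "y \<in> M"
  shows "joined_by_curve x y"
proof -
  define S where "S = {y \<in> M. joined_by_curve x y}"
  have "openin (top_of_set M) S"
    unfolding openin_subopen[of _ S]
  proof
    fix u assume u: "u \<in> S"
    then have "u \<in> M" "joined_by_curve x u" by (auto simp: S_def)
    then obtain W where W: "openin (top_of_set M) W" "u \<in> W"
      "\<And>v. v \<in> W \<Longrightarrow> joined_by_curve x v"
      using joined_by_curve_neighbourhood[of u] by metis
    then have "W \<subseteq> S" using openin_imp_subset[OF W(1)] by (auto simp: S_def)
    then show "\<exists>T. openin (top_of_set M) T \<and> u \<in> T \<and> T \<subseteq> S"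
      using W(1,2) by blast
  qed
  moreover have "openin (top_of_set M) (M - S)"
    unfolding openin_subopen[of _ "M - S"]
  proof
    fix u assume u: "u \<in> M - S"
    then obtain W where W: "openin (top_of_set M) W" "u \<in> W"
      "\<And>v. v \<in> W \<Longrightarrow> joined_by_curve x v \<Longrightarrow> joined_by_curve x u"
      using joined_by_curve_neighbourhood[of u] by (metis DiffD1)
    then have "W \<subseteq> M - S" using openin_imp_subset[OF W(1)] u by (auto simp: S_def)
    then show "\<exists>T. openin (top_of_set M) T \<and> u \<in> T \<and> T \<subseteq> M - S"
      using W(1,2) by blast
  qed
  then have "closedin (top_of_set M) S" by (simp add: closedin_def S_def)
  moreover have "x \<in> S" using joined_by_curve_refl assms(2) by (simp add: S_def)
  ultimately have "S = M" using assms(1) unfolding connected_clopen by blast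
  then show ?thesis using assms(3) by (auto simp: S_def)
qed

lemma riem_dist_le_curve_length:
  assumes "a \<le> b" "piecewise_C1_curve M A a b \<gamma>" "\<gamma> a = x" "\<gamma> b = y"
  shows "riem_dist M A g x y \<le> curve_length A g a b \<gamma>"
  unfolding riem_dist_def
proof (rule cInf_lower)
  show "bdd_below {curve_length A g a b \<gamma> | a b \<gamma>.
      a \<le> b \<and> piecewise_C1_curve M A a b \<gamma> \<and> \<gamma> a = x \<and> \<gamma> b = y}"
    by (rule bdd_belowI[of _ 0]) (use curve_length_nonneg in blast)
qed (use assms in blast)

text \<open>
  Since the set of lengths is nonempty, its infimum is approximated by lengths of actual curves.
\<close>

lemma riem_dist_less_imp_curve:
  assumes "connected M" "x \<in> M" "y \<in> M" "riem_dist M A g x y < r"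
  obtains a b \<gamma> where "a \<le> b" "piecewise_C1_curve M A a b \<gamma>" "\<gamma> a = x" "\<gamma> b = y"
    "curve_length A g a b \<gamma> < r"
proof -
  have "{curve_length A g a b \<gamma> | a b \<gamma>.
      a \<le> b \<and> piecewise_C1_curve M A a b \<gamma> \<and> \<gamma> a = x \<and> \<gamma> b = y} \<noteq> {}"
    using connected_imp_joined_by_curve[OF assms(1-3)] unfolding joined_by_curve_def by blast
  from cInf_lessD[OF this] assms(4) show ?thesis
    unfolding riem_dist_def using that by blast
qed

section \<open>Expanding maps in coordinates\<close>

lemma expanding_mapsD:
  assumes "f \<in> expanding_maps M A g lam \<Gamma>"
  shows "continuous_on M f" "f ` M \<subseteq> M"
    and "\<And>c c'. c \<in> A \<Longrightarrow> c' \<in> A \<Longrightarrow>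
        Ck_on (Suc (Suc 0)) (cmap c ` {p \<in> cdom c. f p \<in> cdom c'}) (loc_rep c f c')"
    and "\<And>c c' p v. c \<in> A \<Longrightarrow> c' \<in> A \<Longrightarrow> p \<in> cdom c \<Longrightarrow> f p \<in> cdom c' \<Longrightarrow>
        lam * tnorm g c p v \<le> tnorm g c' (f p) (tangent_map c f c' p v)"
    and "\<And>c c' p v. c \<in> A \<Longrightarrow> c' \<in> A \<Longrightarrow> p \<in> cdom c \<Longrightarrow> f p \<in> cdom c' \<Longrightarrow> tnorm g c p v \<le> 1 \<Longrightarrow>
        tnorm g c' (f p) (tangent_map c f c' p v) \<le> \<Gamma>"
    and "\<And>c c' p u v. c \<in> A \<Longrightarrow> c' \<in> A \<Longrightarrow> p \<in> cdom c \<Longrightarrow> f p \<in> cdom c' \<Longrightarrow>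
        tnorm g c p u \<le> 1 \<Longrightarrow> tnorm g c p v \<le> 1 \<Longrightarrow> tnorm g c' (f p) (second_deriv g c f c' p u v) \<le> \<Gamma>"
proof -
  have f: "C2_map M A f" "C2_norm A g f \<le> ereal \<Gamma>"
    and exp: "\<forall>c\<in>A. \<forall>c'\<in>A. \<forall>p v. p \<in> cdom c \<and> f p \<in> cdom c' \<longrightarrow>
            tnorm g c' (f p) (tangent_map c f c' p v) \<ge> lam * tnorm g c p v"
    using assms unfolding expanding_maps_def by blast+
  show "continuous_on M f" "f ` M \<subseteq> M" using f(1) unfolding C2_map_def by blast+
  show "Ck_on (Suc (Suc 0)) (cmap c ` {p \<in> cdom c. f p \<in> cdom c'}) (loc_rep c f c')"
    if "c \<in> A" "c' \<in> A" for c c'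
    using f(1) that unfolding C2_map_def numeral_2_eq_2 by blast
  show "lam * tnorm g c p v \<le> tnorm g c' (f p) (tangent_map c f c' p v)"
    if "c \<in> A" "c' \<in> A" "p \<in> cdom c" "f p \<in> cdom c'" for c c' p v
    using exp that by blast
  note bounds = f(2)[unfolded C2_norm_def max.bounded_iff Sup_le_iff]
  show "tnorm g c' (f p) (tangent_map c f c' p v) \<le> \<Gamma>"
    if "c \<in> A" "c' \<in> A" "p \<in> cdom c" "f p \<in> cdom c'" "tnorm g c p v \<le> 1" for c c' p v
  proof -
    have "ereal (tnorm g c' (f p) (tangent_map c f c' p v)) \<le> ereal \<Gamma>"
      by (rule bspec[OF conjunct1[OF bounds]]) (use that in blast)
    then show ?thesis by simp
  qed
  show "tnorm g c' (f p) (second_deriv g c f c' p u v) \<le> \<Gamma>"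
    if "c \<in> A" "c' \<in> A" "p \<in> cdom c" "f p \<in> cdom c'" "tnorm g c p u \<le> 1" "tnorm g c p v \<le> 1" for c c' p u v
  proof -
    have "ereal (tnorm g c' (f p) (second_deriv g c f c' p u v)) \<le> ereal \<Gamma>"
      by (rule bspec[OF conjunct2[OF bounds]]) (use that in blast)
    then show ?thesis by simp
  qed
qed

lemma tangent_map_linear:
  assumes "c \<in> A" "Ck_on (Suc k) (cmap c ` {p \<in> cdom c. h p \<in> cdom c'}) (loc_rep c h c')"
    and "p \<in> cdom c" "h p \<in> cdom c'"
  shows "linear (tangent_map c h c' p)"
  using loc_rep_has_derivative[OF assms] has_derivative_linear by blast

lemma tangent_map_tnorm_upper:
  assumes f: "f \<in> expanding_maps M A g lam \<Gamma>" and c: "c \<in> A" "c' \<in> A" "p \<in> cdom c" "f p \<in> cdom c'"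
  shows "tnorm g c' (f p) (tangent_map c f c' p v) \<le> \<Gamma> * tnorm g c p v"
proof (cases "v = 0")
  case True
  have lin: "linear (tangent_map c f c' p)"
    by (rule tangent_map_linear[OF c(1) expanding_mapsD(3)[OF f c(1,2)] c(3,4)])
  show ?thesis
    using True linear_0[OF lin] tnorm_scaleR[OF c(1,3), of 0 v] tnorm_scaleR[OF c(2,4), of 0 0] by simp
next
  case False
  define r where "r = tnorm g c p v"
  have r: "r > 0" using metric_pos[OF c(1,3) False] by (simp add: r_def tnorm_def)
  have lin: "linear (tangent_map c f c' p)"
    by (rule tangent_map_linear[OF c(1) expanding_mapsD(3)[OF f c(1,2)] c(3,4)])
  have "tnorm g c p ((1 / r) *\<^sub>R v) \<le> 1"
    using r tnorm_scaleR[OF c(1,3), of "1 / r" v] by (simp add: r_def[symmetric])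
  from expanding_mapsD(5)[OF f c this]
  have "tnorm g c' (f p) ((1 / r) *\<^sub>R tangent_map c f c' p v) \<le> \<Gamma>" by (simp add: linear_scale[OF lin])
  then show ?thesis
    using r tnorm_scaleR[OF c(2,4), of "1 / r"] by (simp add: r_def[symmetric] field_simps)
qed

text \<open>
  Passing from coordinates to the Riemannian norm and back costs one factor \<open>\<kappa>\<close> at \<open>p\<close> and one at \<open>f p\<close>.
\<close>

lemma tangent_map_norm_bounds:
  assumes f: "f \<in> expanding_maps M A g lam \<Gamma>" and c: "c \<in> A" "c' \<in> A" "p \<in> cdom c" "f p \<in> cdom c'"
    and b: "chart_bounds \<kappa> c p" "chart_bounds \<kappa> c' (f p)" and "1 \<le> \<kappa>" "1 \<le> lam" "0 \<le> \<Gamma>"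
  shows "norm v \<le> \<kappa>\<^sup>2 * norm (tangent_map c f c' p v)"
    and "norm (tangent_map c f c' p v) \<le> \<kappa>\<^sup>2 * \<Gamma> * norm v"
proof -
  define T where "T = tangent_map c f c' p v"
  have n: "0 \<le> tnorm g c p v" using tnorm_nonneg[OF c(1,3)] .
  have "norm v \<le> \<kappa> * tnorm g c p v" using b(1) by (simp add: chart_bounds_def)
  also have "\<dots> \<le> \<kappa> * (lam * tnorm g c p v)"
    using assms(8,9) n by (intro mult_left_mono) (simp_all add: mult_le_cancel_right1)
  also have "\<dots> \<le> \<kappa> * tnorm g c' (f p) T"
    using expanding_mapsD(4)[OF f c] assms(8) by (simp add: T_def)
  also have "\<dots> \<le> \<kappa> * (\<kappa> * norm T)" using b(2) assms(8) by (simp add: chart_bounds_def)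
  finally show "norm v \<le> \<kappa>\<^sup>2 * norm T" by (simp add: power2_eq_square)
  have "norm T \<le> \<kappa> * tnorm g c' (f p) T" using b(2) by (simp add: chart_bounds_def)
  also have "\<dots> \<le> \<kappa> * (\<Gamma> * tnorm g c p v)"
    using tangent_map_tnorm_upper[OF f c] assms(8) by (simp add: T_def)
  also have "\<dots> \<le> \<kappa> * (\<Gamma> * (\<kappa> * norm v))"
    using b(1) assms(8,10) by (intro mult_left_mono) (simp_all add: chart_bounds_def)
  finally show "norm T \<le> \<kappa>\<^sup>2 * \<Gamma> * norm v" by (simp add: power2_eq_square ac_simps)
qed

text \<open>
  In coordinates \<open>D\<^sup>2F(u,v) = \<nabla>Df(u,v) - C'(DF u, DF v) + DF(C(u,v))\<close>, where \<open>C\<close> and \<open>C'\<close> stand for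
  the Christoffel symbols at \<open>p\<close> and at \<open>f p\<close>. The three summands of the constant bound the three terms.
\<close>

lemma second_derivative_bound:
  assumes f: "f \<in> expanding_maps M A g lam \<Gamma>" and c: "c \<in> A" "c' \<in> A" "p \<in> cdom c" "f p \<in> cdom c'"
    and b: "chart_bounds \<kappa> c p" "chart_bounds \<kappa> c' (f p)" and \<kappa>: "1 \<le> \<kappa>" "1 \<le> lam" "0 \<le> \<Gamma>"
  shows "norm (frechet_derivative (\<lambda>x. frechet_derivative (loc_rep c f c') (at x) v) (at (cmap c p)) u)
    \<le> (\<kappa>^3 * \<Gamma> + \<kappa> * (\<kappa>\<^sup>2 * \<Gamma>)\<^sup>2 + \<kappa>^3 * \<Gamma>) * norm u * norm v"
proof -
  define S where "S = cmap c ` {p \<in> cdom c. f p \<in> cdom c'}"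
  define F where "F = loc_rep c f c'"
  define H where "H u v = frechet_derivative (\<lambda>x. frechet_derivative F (at x) v) (at (cmap c p)) u" for u v
  have S: "open S" "cmap c p \<in> S"
    unfolding S_def using open_loc_rep_domain[OF c(1,2) expanding_mapsD(1,2)[OF f]] c(3,4) by auto
  have C2: "Ck_on (Suc (Suc 0)) S F" unfolding S_def F_def by (rule expanding_mapsD(3)[OF f c(1,2)])
  have Hder: "((\<lambda>x. frechet_derivative F (at x) v) has_derivative (\<lambda>u. H u v)) (at (cmap c p))" for v
    using C2 S(2) unfolding H_def by (simp add: frechet_derivative_works)
  have H1: "H (r *\<^sub>R u) v = r *\<^sub>R H u v" for r u v
    using linear_scale[OF has_derivative_linear[OF Hder]] .
  have H2: "H u (r *\<^sub>R v) = r *\<^sub>R H u v" for r u v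
  proof -
    have "((\<lambda>x. r *\<^sub>R frechet_derivative F (at x) v) has_derivative (\<lambda>u. r *\<^sub>R H u v)) (at (cmap c p))"
      by (rule has_derivative_scaleR_right[OF Hder])
    then have "((\<lambda>x. frechet_derivative F (at x) (r *\<^sub>R v)) has_derivative (\<lambda>u. r *\<^sub>R H u v)) (at (cmap c p))"
    proof (rule has_derivative_transform_within_open[OF _ S])
      fix x assume "x \<in> S"
      then have "linear (frechet_derivative F (at x))"
        using C2 by (intro linear_frechet_derivative) simp
      then show "r *\<^sub>R frechet_derivative F (at x) v = frechet_derivative F (at x) (r *\<^sub>R v)"
        by (simp add: linear_scale)
    qed
    from has_derivative_unique[OF this Hder] show ?thesis by metis
  qed
  define K where "K = \<kappa>^3 * \<Gamma> + \<kappa> * (\<kappa>\<^sup>2 * \<Gamma>)\<^sup>2 + \<kappa>^3 * \<Gamma>"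
  \<comment> \<open>Vectors of coordinate norm \<open>1 / \<kappa>\<close> have Riemannian norm at most 1, so the \<open>C\<^sup>2\<close>-norm applies to
    them; the general case follows because \<open>H\<close> is homogeneous in each argument.\<close>
  have small: "\<kappa>\<^sup>2 * norm (H u v) \<le> K" if uv: "norm u = 1 / \<kappa>" "norm v = 1 / \<kappa>" for u v
  proof -
    let ?T = "tangent_map c f c' p"
    note T = tangent_map_norm_bounds(2)[OF f c b \<kappa>]
    have t1: "tnorm g c p w \<le> 1" if "norm w = 1 / \<kappa>" for w
    proof -
      have "tnorm g c p w \<le> \<kappa> * norm w" using b(1) by (simp add: chart_bounds_def)
      then show ?thesis using that \<kappa>(1) by simp
    qed
    have "norm (second_deriv g c f c' p u v) \<le> \<kappa> * tnorm g c' (f p) (second_deriv g c f c' p u v)"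
      using b(2) by (simp add: chart_bounds_def)
    also have "\<dots> \<le> \<kappa> * \<Gamma>"
      using expanding_mapsD(6)[OF f c t1[OF uv(1)] t1[OF uv(2)]] \<kappa>(1) by simp
    finally have n1: "norm (second_deriv g c f c' p u v) \<le> \<kappa> * \<Gamma>" .
    have "norm (christoffel g c' (f p) (?T u) (?T v)) \<le> \<kappa> * norm (?T u) * norm (?T v)"
      using b(2) by (simp add: chart_bounds_def)
    also have "\<dots> \<le> \<kappa> * (\<kappa>\<^sup>2 * \<Gamma> * norm u) * (\<kappa>\<^sup>2 * \<Gamma> * norm v)"
      using T[of u] T[of v] \<kappa> by (intro mult_mono mult_left_mono) auto
    finally have n2: "norm (christoffel g c' (f p) (?T u) (?T v)) \<le> \<kappa> * (\<kappa>\<^sup>2 * \<Gamma>)\<^sup>2 * (1 / \<kappa>\<^sup>2)"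
      using uv \<kappa>(1) by (simp add: power2_eq_square ac_simps)
    have "norm (?T (christoffel g c p u v)) \<le> \<kappa>\<^sup>2 * \<Gamma> * norm (christoffel g c p u v)" by (rule T)
    also have "\<dots> \<le> \<kappa>\<^sup>2 * \<Gamma> * (\<kappa> * norm u * norm v)"
      using b(1) \<kappa> by (intro mult_left_mono) (simp_all add: chart_bounds_def)
    finally have n3: "norm (?T (christoffel g c p u v)) \<le> \<kappa>\<^sup>2 * \<Gamma> * \<kappa> * (1 / \<kappa>\<^sup>2)"
      using uv \<kappa>(1) by (simp add: power2_eq_square ac_simps)
    have "H u v = second_deriv g c f c' p u v - christoffel g c' (f p) (?T u) (?T v) + ?T (christoffel g c p u v)"
      by (simp add: second_deriv_def H_def F_def)
    then have "norm (H u v) \<le> \<kappa> * \<Gamma> + \<kappa> * (\<kappa>\<^sup>2 * \<Gamma>)\<^sup>2 * (1 / \<kappa>\<^sup>2) + \<kappa>\<^sup>2 * \<Gamma> * \<kappa> * (1 / \<kappa>\<^sup>2)"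
      using n1 n2 n3 by (metis (no_types, lifting) add_mono norm_triangle_mono norm_triangle_le_diff)
    from mult_left_mono[OF this, of "\<kappa>\<^sup>2"]
    have "\<kappa>\<^sup>2 * norm (H u v) \<le> \<kappa>\<^sup>2 * (\<kappa> * \<Gamma> + \<kappa> * (\<kappa>\<^sup>2 * \<Gamma>)\<^sup>2 * (1 / \<kappa>\<^sup>2) + \<kappa>\<^sup>2 * \<Gamma> * \<kappa> * (1 / \<kappa>\<^sup>2))"
      by simp
    also have "\<dots> = K" using \<kappa>(1) by (simp add: K_def field_simps power2_eq_square power3_eq_cube)
    finally show ?thesis .
  qed
  have "norm (H u v) \<le> K * norm u * norm v"
  proof (cases "u = 0 \<or> v = 0")
    case True
    then have "H u v = 0" using H1[of 0 u v] H2[of u 0 v] by auto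
    then show ?thesis using True by auto
  next
    case False
    define u' v' where "u' = (1 / (\<kappa> * norm u)) *\<^sub>R u" and "v' = (1 / (\<kappa> * norm v)) *\<^sub>R v"
    have uv': "norm u' = 1 / \<kappa>" "norm v' = 1 / \<kappa>" "u = (\<kappa> * norm u) *\<^sub>R u'" "v = (\<kappa> * norm v) *\<^sub>R v'"
      using False \<kappa>(1) by (simp_all add: u'_def v'_def)
    have "H u v = (\<kappa> * norm u) *\<^sub>R (\<kappa> * norm v) *\<^sub>R H u' v'"
      using H1[of "\<kappa> * norm u" u' "(\<kappa> * norm v) *\<^sub>R v'"] H2[of u' "\<kappa> * norm v" v'] uv'(3,4) by simp
    then have "norm (H u v) = (\<kappa>\<^sup>2 * norm (H u' v')) * (norm u * norm v)"
      using \<kappa>(1) by (simp add: power2_eq_square)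
    also have "\<dots> \<le> K * (norm u * norm v)" using small[OF uv'(1,2)] by (intro mult_right_mono) auto
    finally show ?thesis by simp
  qed
  then show ?thesis by (simp add: H_def F_def K_def)
qed

section \<open>Lifting curves through a local inverse\<close>

text \<open>
  With \<open>G\<close> the inverse of the coordinate expression \<open>F\<close> of \<open>f\<close>, the lift of \<open>\<gamma>\<close> is the curve with coordinates
  \<open>G (cmap c' (\<gamma> \<tau>))\<close>. It is \<open>C\<^sup>1\<close> wherever \<open>\<gamma>\<close> is, because \<open>G\<close> is differentiable with derivative the inverse of
  that of \<open>F\<close>. As \<open>\<gamma>\<close> is the image of the lift under \<open>f\<close>, the speed of \<open>\<gamma>\<close> is at least \<open>lam\<close> times that of the lift.
\<close>

lemma lift_curve_through_local_inverse:
  assumes f: "f \<in> expanding_maps M A g lam \<Gamma>" and "0 < lam"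
    and c: "c \<in> A" "c' \<in> A"
    and B0: "B0 \<subseteq> cmap c ` {p \<in> cdom c. f p \<in> cdom c'}"
    and \<beta>: "\<beta> > 0" "\<And>z w. z \<in> B0 \<Longrightarrow> w \<in> B0 \<Longrightarrow>
        \<beta> * norm (z - w) \<le> norm (loc_rep c f c' z - loc_rep c f c' w)"
      "\<And>z v. z \<in> B0 \<Longrightarrow> \<beta> * norm v \<le> norm (frechet_derivative (loc_rep c f c') (at z) v)"
    and U: "open U" "U \<subseteq> loc_rep c f c' ` B0"
    and \<gamma>: "piecewise_C1_curve M A a b \<gamma>"
    and \<gamma>U: "\<And>\<tau>. \<tau> \<in> {a..b} \<Longrightarrow> \<gamma> \<tau> \<in> cdom c' \<and> cmap c' (\<gamma> \<tau>) \<in> U"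
  obtains \<sigma> where "piecewise_C1_curve M A a b \<sigma>"
    "\<And>\<tau>. \<tau> \<in> {a..b} \<Longrightarrow> \<sigma> \<tau> \<in> cinv c ` B0 \<and> f (\<sigma> \<tau>) = \<gamma> \<tau>"
    "lam * curve_length A g a b \<sigma> \<le> curve_length A g a b \<gamma>"
proof -
  define F where "F = loc_rep c f c'"
  define S where "S = cmap c ` {p \<in> cdom c. f p \<in> cdom c'}"
  define G where "G = inv_into B0 F"
  have C2: "Ck_on (Suc (Suc 0)) S F" unfolding S_def F_def by (rule expanding_mapsD(3)[OF f c])
  have B0S: "B0 \<subseteq> S" using B0 by (simp add: S_def)
  have B0V: "B0 \<subseteq> cmap c ` cdom c" using B0 by blast
  have G: "G y \<in> B0" "F (G y) = y" if "y \<in> U" for y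
    using U(2) that unfolding G_def F_def by (auto intro: inv_into_into f_inv_into_f)
  have G_lip: "norm (G y - G y') \<le> (1 / \<beta>) * norm (y - y')" if "y \<in> U" "y' \<in> U" for y y'
    using \<beta>(1) \<beta>(2)[OF G(1)[OF that(1)] G(1)[OF that(2)]] G(2) that
    by (simp add: F_def[symmetric] field_simps)
  have "(1 / \<beta>)-lipschitz_on U G"
    using G_lip \<beta>(1) by (intro lipschitz_onI) (auto simp: dist_norm)
  then have contG: "continuous_on U G" by (rule lipschitz_on_continuous_on)
  have Fder: "(F has_derivative frechet_derivative F (at (G y))) (at (G y))" if "y \<in> U" for y
    using Ck_on_Suc_has_derivative[OF C2] G(1)[OF that] B0S by blast
  have "\<exists>T'. linear T' \<and> (\<forall>v. T' (frechet_derivative F (at (G y)) v) = v) \<and>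
      (\<forall>v. frechet_derivative F (at (G y)) (T' v) = v)" if "y \<in> U" for y
    using linear_inverse_of_lower_bound[OF has_derivative_linear[OF Fder[OF that]] \<beta>(1)
        \<beta>(3)[OF G(1)[OF that], folded F_def]] by metis
  then obtain G' where G': "\<And>y. y \<in> U \<Longrightarrow> linear (G' y)"
    "\<And>y v. y \<in> U \<Longrightarrow> G' y (frechet_derivative F (at (G y)) v) = v"
    "\<And>y v. y \<in> U \<Longrightarrow> frechet_derivative F (at (G y)) (G' y v) = v"
    by metis
  have Gder: "(G has_derivative G' y) (at y)" if "y \<in> U" for y
  proof (rule has_derivative_inverse_basic[OF Fder[OF that] _ _ _ U(1) that G(2)])
    show "bounded_linear (G' y)" using G'(1)[OF that] by (simp add: linear_conv_bounded_linear)
    show "G' y \<circ> frechet_derivative F (at (G y)) = id" using G'(2)[OF that] by (simp add: fun_eq_iff)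
    show "continuous (at y) G" using contG U(1) that by (simp add: continuous_on_eq_continuous_at)
  qed
  define \<psi> where "\<psi> \<tau> = G (cmap c' (\<gamma> \<tau>))" for \<tau>
  define \<sigma> where "\<sigma> \<tau> = id (cinv c (\<psi> \<tau>))" for \<tau>
  have \<psi>: "\<psi> \<tau> \<in> B0" "F (\<psi> \<tau>) = cmap c' (\<gamma> \<tau>)" if "\<tau> \<in> {a..b}" for \<tau>
    using G \<gamma>U[OF that] by (simp_all add: \<psi>_def)
  have \<sigma>B0: "\<sigma> \<tau> \<in> cinv c ` B0" if "\<tau> \<in> {a..b}" for \<tau>
    using \<psi>(1)[OF that] by (simp add: \<sigma>_def)
  have dom: "\<sigma> \<tau> \<in> cdom c" "f (\<sigma> \<tau>) \<in> cdom c'" "cmap c (\<sigma> \<tau>) = \<psi> \<tau>" "f (\<sigma> \<tau>) = \<gamma> \<tau>" if \<tau>: "\<tau> \<in> {a..b}" for \<tau>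
  proof -
    obtain p where p: "\<psi> \<tau> = cmap c p" "p \<in> cdom c" "f p \<in> cdom c'"
      using B0 \<psi>(1)[OF \<tau>] by blast
    have "\<sigma> \<tau> = p" using p cinv_cmap[OF c(1)] by (simp add: \<sigma>_def)
    then show "\<sigma> \<tau> \<in> cdom c" "f (\<sigma> \<tau>) \<in> cdom c'" "cmap c (\<sigma> \<tau>) = \<psi> \<tau>" using p by simp_all
    have "cmap c' (f (\<sigma> \<tau>)) = cmap c' (\<gamma> \<tau>)"
      using \<psi>(2)[OF \<tau>] by (simp add: F_def loc_rep_def \<sigma>_def)
    then show "f (\<sigma> \<tau>) = \<gamma> \<tau>"
      using cinv_cmap[OF c(2) \<open>f (\<sigma> \<tau>) \<in> cdom c'\<close>] cinv_cmap[OF c(2), of "\<gamma> \<tau>"] \<gamma>U[OF \<tau>] by metis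
  qed
  note \<gamma>c = piecewise_C1_curveD[OF \<gamma>]
  have cont\<gamma>': "continuous_on {a..b} (\<lambda>\<tau>. cmap c' (\<gamma> \<tau>))"
  proof (rule continuous_on_compose2[OF _ \<gamma>c(1)])
    show "continuous_on (cdom c') (cmap c')"
      using chart_homeomorphism[OF c(2)] by (simp add: homeomorphism_def)
    show "\<gamma> ` {a..b} \<subseteq> cdom c'" using \<gamma>U by (simp add: image_subset_iff)
  qed
  have cont\<psi>: "continuous_on {a..b} \<psi>"
    unfolding \<psi>_def by (rule continuous_on_compose2[OF contG cont\<gamma>']) (use \<gamma>U in \<open>simp add: image_subset_iff\<close>)
  have cont\<sigma>: "continuous_on {a..b} \<sigma>"
    unfolding \<sigma>_def id_apply
  proof (rule continuous_on_compose2[OF _ cont\<psi>])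
    show "continuous_on (cmap c ` cdom c) (cinv c)"
      using chart_homeomorphism[OF c(1)] by (simp add: homeomorphism_def)
    show "\<psi> ` {a..b} \<subseteq> cmap c ` cdom c" by (intro image_subsetI subsetD[OF B0V] \<psi>)
  qed
  have \<sigma>M: "\<sigma> ` {a..b} \<subseteq> M"
    by (intro image_subsetI subsetD[OF chart_domain_subset[OF c(1)]] dom(1))
  have C1: "C1_curve A s t \<sigma>" if st: "a \<le> s" "s < t" "t \<le> b" and \<gamma>C1: "C1_curve A s t \<gamma>" for s t
  proof -
    have sub: "{s..t} \<subseteq> {a..b}" using st by auto
    define E where "E \<tau> = vector_derivative (cmap c' \<circ> \<gamma>) (at \<tau> within {s..t})" for \<tau>
    have "{\<tau> \<in> {s..t}. \<gamma> \<tau> \<in> cdom c'} = {s..t}" using \<gamma>U sub by blast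
    then have contE: "continuous_on {s..t} E"
      using C1_curve_velocity(1)[OF \<gamma>C1 st(2) c(2)] by (simp add: E_def)
    have E: "((cmap c' \<circ> \<gamma>) has_vector_derivative E \<tau>) (at \<tau> within {s..t})" if "\<tau> \<in> {s..t}" for \<tau>
      using C1_curve_velocity(2)[OF \<gamma>C1 st(2) c(2) that] \<gamma>U sub that unfolding E_def by blast
    define D where "D \<tau> = G' (cmap c' (\<gamma> \<tau>)) (E \<tau>)" for \<tau>
    have D: "frechet_derivative F (at (\<psi> \<tau>)) (D \<tau>) = E \<tau>" if "\<tau> \<in> {s..t}" for \<tau>
      unfolding D_def \<psi>_def using \<gamma>U sub that by (intro G'(3)) blast
    have \<psi>': "(\<psi> has_vector_derivative D \<tau>) (at \<tau> within {s..t})" if \<tau>: "\<tau> \<in> {s..t}" for \<tau>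
    proof -
      have "(G has_derivative G' ((cmap c' \<circ> \<gamma>) \<tau>)) (at ((cmap c' \<circ> \<gamma>) \<tau>) within (cmap c' \<circ> \<gamma>) ` {s..t})"
        by (rule has_derivative_at_withinI[OF Gder]) (use \<gamma>U sub \<tau> in auto)
      from vector_derivative_diff_chain_within[OF E[OF \<tau>] this]
      show ?thesis by (simp add: D_def \<psi>_def[abs_def] o_def)
    qed
    have contD: "continuous_on {s..t} D"
      unfolding continuous_on_def
    proof
      fix \<tau>0 assume \<tau>0: "\<tau>0 \<in> {s..t}"
      have "continuous_on {s..t} (\<lambda>\<tau>. frechet_derivative F (at (\<psi> \<tau>)) (D \<tau>0))"
      proof (rule Ck_on_continuous_derivative[OF C2])
        show "continuous_on {s..t} \<psi>" using cont\<psi> sub continuous_on_subset by blast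
        show "\<psi> ` {s..t} \<subseteq> S" using \<psi>(1) sub B0S by blast
      qed simp
      then have "((\<lambda>\<tau>. (1 / \<beta>) * norm (E \<tau> - frechet_derivative F (at (\<psi> \<tau>)) (D \<tau>0))) \<longlongrightarrow>
          (1 / \<beta>) * norm (E \<tau>0 - frechet_derivative F (at (\<psi> \<tau>0)) (D \<tau>0))) (at \<tau>0 within {s..t})"
        using contE \<tau>0 unfolding continuous_on_def by (intro tendsto_intros) auto
      then have lim: "((\<lambda>\<tau>. (1 / \<beta>) * norm (E \<tau> - frechet_derivative F (at (\<psi> \<tau>)) (D \<tau>0))) \<longlongrightarrow> 0)
          (at \<tau>0 within {s..t})"
        using D[OF \<tau>0] by simp
      \<comment> \<open>The lower bound for the derivative of \<open>F\<close>, applied to \<open>D \<tau> - D \<tau>0\<close>, leaves a quantity in which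
        this derivative acts only on the fixed vector \<open>D \<tau>0\<close>, and which therefore tends to 0.\<close>
      have "norm (D \<tau> - D \<tau>0) \<le> (1 / \<beta>) * norm (E \<tau> - frechet_derivative F (at (\<psi> \<tau>)) (D \<tau>0))"
        if \<tau>: "\<tau> \<in> {s..t}" for \<tau>
      proof -
        have B: "\<psi> \<tau> \<in> B0" using \<psi>(1) sub \<tau> by blast
        have "linear (frechet_derivative F (at (\<psi> \<tau>)))"
          using Ck_on_Suc_has_derivative[OF C2 subsetD[OF B0S B]] has_derivative_linear by blast
        then have "frechet_derivative F (at (\<psi> \<tau>)) (D \<tau> - D \<tau>0) = E \<tau> - frechet_derivative F (at (\<psi> \<tau>)) (D \<tau>0)"
          using D[OF \<tau>] by (simp add: linear_diff)
        then have "\<beta> * norm (D \<tau> - D \<tau>0) \<le> norm (E \<tau> - frechet_derivative F (at (\<psi> \<tau>)) (D \<tau>0))"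
          using \<beta>(3)[OF B, of "D \<tau> - D \<tau>0", folded F_def] by simp
        then show ?thesis using \<beta>(1) by (simp add: pos_le_divide_eq mult.commute)
      qed
      then have "((\<lambda>\<tau>. D \<tau> - D \<tau>0) \<longlongrightarrow> 0) (at \<tau>0 within {s..t})"
        by (intro Lim_null_comparison[OF _ lim]) (simp add: eventually_at_filter)
      then show "(D \<longlongrightarrow> D \<tau>0) (at \<tau>0 within {s..t})" by (simp add: LIM_zero_iff)
    qed
    have "\<psi> ` {s..t} \<subseteq> cmap c ` cdom c" by (intro image_subsetI subsetD[OF B0V] \<psi> subsetD[OF sub])
    from C1_curve_from_chart[OF c(1) smooth_transition[OF c(1), of _ "Suc 0"] this \<psi>' contD]
    show ?thesis unfolding \<sigma>_def by blast
  qed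
  have \<sigma>: "piecewise_C1_curve M A a b \<sigma>"
    using cont\<sigma> \<sigma>M C1 \<gamma> unfolding piecewise_C1_curve_def by meson
  obtain B1 where B1: "finite B1"
    "\<And>\<tau> c. \<tau> \<in> {a<..<b} - B1 \<Longrightarrow> c \<in> A \<Longrightarrow> \<gamma> \<tau> \<in> cdom c \<Longrightarrow>
      ((cmap c \<circ> \<gamma>) has_vector_derivative vector_derivative (cmap c \<circ> \<gamma>) (at \<tau>)) (at \<tau>) \<and>
      speed A g \<gamma> \<tau> = tnorm g c (\<gamma> \<tau>) (vector_derivative (cmap c \<circ> \<gamma>) (at \<tau>))"
    using piecewise_C1_curve_speed[OF \<gamma>] by blast
  obtain B2 where B2: "finite B2"
    "\<And>\<tau> c. \<tau> \<in> {a<..<b} - B2 \<Longrightarrow> c \<in> A \<Longrightarrow> \<sigma> \<tau> \<in> cdom c \<Longrightarrow>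
      ((cmap c \<circ> \<sigma>) has_vector_derivative vector_derivative (cmap c \<circ> \<sigma>) (at \<tau>)) (at \<tau>) \<and>
      speed A g \<sigma> \<tau> = tnorm g c (\<sigma> \<tau>) (vector_derivative (cmap c \<circ> \<sigma>) (at \<tau>))"
    using piecewise_C1_curve_speed[OF \<sigma>] by blast
  have "lam * speed A g \<sigma> \<tau> \<le> speed A g \<gamma> \<tau>" if \<tau>: "\<tau> \<in> {a<..<b} - (B1 \<union> B2)" for \<tau>
  proof -
    define v where "v = vector_derivative (cmap c \<circ> \<sigma>) (at \<tau>)"
    have \<tau>': "\<tau> \<in> {a..b}" "\<tau> \<in> {a<..<b}" "\<tau> \<in> {a<..<b} - B1" "\<tau> \<in> {a<..<b} - B2" using \<tau> by auto
    have at: "at \<tau> within {a..b} = at \<tau>" using \<tau>'(2) by (simp add: at_within_Icc_at)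
    have v: "((cmap c \<circ> \<sigma>) has_vector_derivative v) (at \<tau> within {a..b})"
      "speed A g \<sigma> \<tau> = tnorm g c (\<sigma> \<tau>) v"
      using B2(2)[OF \<tau>'(4) c(1) dom(1)[OF \<tau>'(1)]] unfolding at v_def by blast+
    have "((cmap c' \<circ> (f \<circ> \<sigma>)) has_vector_derivative tangent_map c f c' (\<sigma> \<tau>) v) (at \<tau> within {a..b})"
      by (rule curve_chart_change_derivative[OF c(1) expanding_mapsD(3)[OF f c] cont\<sigma> \<sigma>M \<tau>'(1)
            dom(1,2)[OF \<tau>'(1)] v(1)])
    then have "((cmap c' \<circ> \<gamma>) has_vector_derivative tangent_map c f c' (\<sigma> \<tau>) v) (at \<tau> within {a..b})"
      by (rule has_vector_derivative_transform[OF \<tau>'(1), rotated]) (simp add: dom(4))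
    then have "vector_derivative (cmap c' \<circ> \<gamma>) (at \<tau>) = tangent_map c f c' (\<sigma> \<tau>) v"
      unfolding at by (rule vector_derivative_at)
    then have "speed A g \<gamma> \<tau> = tnorm g c' (f (\<sigma> \<tau>)) (tangent_map c f c' (\<sigma> \<tau>) v)"
      using B1(2)[OF \<tau>'(3) c(2)] \<gamma>U[OF \<tau>'(1)] dom(4)[OF \<tau>'(1)] by simp
    then show ?thesis
      using expanding_mapsD(4)[OF f c dom(1,2)[OF \<tau>'(1)], of v] v(2) by simp
  qed
  then have "integral {a..b} (\<lambda>\<tau>. lam * speed A g \<sigma> \<tau>) \<le> integral {a..b} (speed A g \<gamma>)"
    using B1(1) B2(1) speed_integrable[OF \<sigma>] speed_integrable[OF \<gamma>]
    by (intro integral_mono_except_finite[of _ _ _ _ "B1 \<union> B2"]) (auto intro: integrable_on_mult_right)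
  then have "lam * curve_length A g a b \<sigma> \<le> curve_length A g a b \<gamma>" by (simp add: curve_length_def)
  then show ?thesis using that[OF \<sigma>] \<sigma>B0 dom(4) by blast
qed

section \<open>Uniform expansion at small scales\<close>

lemma controlled_chartD:
  assumes "controlled_chart \<kappa> c x"
  shows "1 \<le> \<kappa>" "c \<in> A" "x \<in> cdom c" "cball (cmap c x) (1 / \<kappa>) \<subseteq> cmap c ` cdom c"
    and "\<And>z. z \<in> cball (cmap c x) (1 / \<kappa>) \<Longrightarrow> chart_bounds \<kappa> c (cinv c z)"
  using assms unfolding controlled_chart_def by blast+

lemma short_curve_stays_in_controlled_ball:
  assumes \<gamma>: "piecewise_C1_curve M A a b \<gamma>" and c: "controlled_chart \<kappa> c (\<gamma> a)"
    and r: "0 < r" "r \<le> 1 / \<kappa>" and len: "curve_length A g a b \<gamma> < r / \<kappa>" and t: "t \<in> {a..b}"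
  shows "\<gamma> t \<in> cinv c ` ball (cmap c (\<gamma> a)) r"
proof -
  note c' = controlled_chartD[OF c]
  have sub: "ball (cmap c (\<gamma> a)) r \<subseteq> cball (cmap c (\<gamma> a)) (1 / \<kappa>)" using r(2) by auto
  have V: "ball (cmap c (\<gamma> a)) r \<subseteq> cmap c ` cdom c" using sub c'(4) by (rule order_trans)
  have "norm v \<le> \<kappa> * tnorm g c (cinv c z) v" if "z \<in> ball (cmap c (\<gamma> a)) r" for z v
    using c'(5)[OF subsetD[OF sub that]] by (simp add: chart_bounds_def)
  then show ?thesis
    using short_curve_stays_in_chart_ball[OF \<gamma> c'(2,3) r(1) V _ _ len t] c'(1) by simp
qed

text \<open>
  The image of a coordinate segment starting at \<open>cmap c x\<close> is a curve of length at most \<open>\<Gamma> * \<kappa> * \<rho>\<close>, too short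
  to leave the coordinate ball around \<open>f x\<close>. So a coordinate expression of \<open>f\<close> with values in the single chart
  \<open>c'\<close> is available on a ball of uniform radius.
\<close>

lemma expanding_map_maps_chart_ball:
  assumes f: "f \<in> expanding_maps M A g lam \<Gamma>" and "0 \<le> \<Gamma>"
    and c: "controlled_chart \<kappa> c x" "controlled_chart \<kappa> c' (f x)"
    and \<rho>: "\<rho> \<le> 1 / \<kappa>" "\<Gamma> * \<kappa> * \<rho> < 1 / \<kappa> / \<kappa>"
    and z: "z \<in> ball (cmap c x) \<rho>"
  shows "f (cinv c z) \<in> cinv c' ` ball (cmap c' (f x)) (1 / \<kappa>)"
proof -
  note cx = controlled_chartD[OF c(1)]
  define z0 where "z0 = cmap c x"
  define w where "w = z - z0"
  have "norm w < \<rho>" using z by (simp add: w_def z0_def dist_norm norm_minus_commute)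
  then have w: "norm w \<le> \<rho>" "\<rho> > 0" using norm_ge_zero[of w] by linarith+
  have z0: "cinv c z0 = x" unfolding z0_def by (rule cinv_cmap[OF cx(2,3)])
  have sub: "ball z0 \<rho> \<subseteq> cball z0 (1 / \<kappa>)" using \<rho>(1) by auto
  have "z0 \<in> ball z0 \<rho>" using w(2) by simp
  then have seg': "closed_segment z0 z \<subseteq> ball z0 \<rho>"
    using z by (intro closed_segment_subset) (auto simp: z0_def)
  have seg_ball: "closed_segment z0 z \<subseteq> cball z0 (1 / \<kappa>)" using seg' sub by (rule order_trans)
  have seg: "closed_segment z0 z \<subseteq> cmap c ` cdom c"
    using seg_ball cx(4) unfolding z0_def by (rule order_trans)
  define \<sigma> where "\<sigma> = (\<lambda>\<tau>. f (cinv c (z0 + \<tau> *\<^sub>R (z - z0))))"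
  have \<sigma>: "piecewise_C1_curve M A 0 1 \<sigma>"
    unfolding \<sigma>_def
    by (rule segment_image_curve[OF cx(2) expanding_mapsD(3)[OF f cx(2)] expanding_mapsD(1,2)[OF f] seg])
  have \<sigma>01: "\<sigma> 0 = f x" "\<sigma> 1 = f (cinv c z)" by (simp_all add: \<sigma>_def z0)
  have "curve_length A g 0 1 \<sigma> \<le> \<Gamma> * \<kappa> * \<rho>"
    unfolding \<sigma>_def
  proof (rule segment_image_length[OF cx(2) expanding_mapsD(3)[OF f cx(2)] expanding_mapsD(1,2)[OF f] seg])
    fix y c'' assume y: "y \<in> closed_segment z0 z" and c'': "c'' \<in> A" "f (cinv c y) \<in> cdom c''"
    have "tnorm g c'' (f (cinv c y)) (tangent_map c f c'' (cinv c y) w) \<le> \<Gamma> * tnorm g c (cinv c y) w"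
      by (rule tangent_map_tnorm_upper[OF f cx(2) c''(1) cinv_in_domain[OF subsetD[OF seg y]] c''(2)])
    also have "\<dots> \<le> \<Gamma> * (\<kappa> * norm w)"
      using cx(5)[folded z0_def, OF subsetD[OF seg_ball y]] \<open>0 \<le> \<Gamma>\<close>
      by (intro mult_left_mono) (simp_all add: chart_bounds_def)
    also have "\<dots> \<le> \<Gamma> * (\<kappa> * \<rho>)"
      using w(1) cx(1) \<open>0 \<le> \<Gamma>\<close> by (intro mult_left_mono) auto
    finally show "tnorm g c'' (f (cinv c y)) (tangent_map c f c'' (cinv c y) (z - z0)) \<le> \<Gamma> * \<kappa> * \<rho>"
      by (simp add: w_def)
  qed
  then have "curve_length A g 0 1 \<sigma> < 1 / \<kappa> / \<kappa>" using \<rho>(2) by linarith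
  then have "\<sigma> 1 \<in> cinv c' ` ball (cmap c' (\<sigma> 0)) (1 / \<kappa>)"
    using cx(1) c(2)[folded \<sigma>01(1)] by (intro short_curve_stays_in_controlled_ball[OF \<sigma>]) auto
  then show ?thesis by (simp add: \<sigma>01)
qed

text \<open>
  The last condition on \<open>\<rho>\<close> says that \<open>\<rho>\<close> times the bound on second derivatives is at most half of the
  lower bound \<open>1 / \<kappa>\<^sup>2\<close> of the derivative. So \<open>f\<close> is invertible in coordinates near \<open>x\<close>, and short curves
  from \<open>f x\<close> to \<open>f y\<close> lift to curves from \<open>x\<close> to \<open>y\<close> that are shorter by the factor \<open>lam\<close>.
\<close>

lemma expanding_map_local_expansion:
  assumes conn: "connected M"
    and f: "f \<in> expanding_maps M A g lam \<Gamma>" and lam: "1 \<le> lam" and \<Gamma>: "0 \<le> \<Gamma>"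
    and c: "controlled_chart \<kappa> c x" "controlled_chart \<kappa> c' (f x)"
    and \<rho>: "0 < \<rho>" "\<rho> \<le> 1 / \<kappa>" "\<Gamma> * \<kappa> * \<rho> < 1 / \<kappa> / \<kappa>"
      "(\<kappa>^3 * \<Gamma> + \<kappa> * (\<kappa>\<^sup>2 * \<Gamma>)\<^sup>2 + \<kappa>^3 * \<Gamma>) * \<rho> \<le> 1 / \<kappa>\<^sup>2 / 2"
    and xy: "x \<in> M" "y \<in> M"
    and d: "riem_dist M A g x y < \<rho> / \<kappa>" "riem_dist M A g (f x) (f y) < 1 / \<kappa>\<^sup>2 * \<rho> / 2 / \<kappa>"
  shows "lam * riem_dist M A g x y \<le> riem_dist M A g (f x) (f y)"
proof -
  note cx = controlled_chartD[OF c(1)] and cfx = controlled_chartD[OF c(2)]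
  define K where "K = \<kappa>^3 * \<Gamma> + \<kappa> * (\<kappa>\<^sup>2 * \<Gamma>)\<^sup>2 + \<kappa>^3 * \<Gamma>"
  define F where "F = loc_rep c f c'"
  define F' where "F' z v = frechet_derivative F (at z) v" for z v
  define z0 where "z0 = cmap c x"
  define S where "S = cmap c ` {p \<in> cdom c. f p \<in> cdom c'}"
  define r where "r = 1 / \<kappa>\<^sup>2 * \<rho> / 2"
  have C2: "Ck_on (Suc (Suc 0)) S F" unfolding S_def F_def by (rule expanding_mapsD(3)[OF f cx(2) cfx(2)])
  have ball: "ball z0 \<rho> \<subseteq> cball z0 (1 / \<kappa>)" using \<rho>(2) by auto
  have ballV: "ball z0 \<rho> \<subseteq> cmap c ` cdom c" using ball cx(4) unfolding z0_def by (rule order_trans)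
  have dom: "cinv c z \<in> cdom c" "f (cinv c z) \<in> cdom c'" "cmap c (cinv c z) = z"
    "chart_bounds \<kappa> c (cinv c z)" "chart_bounds \<kappa> c' (f (cinv c z))" if z: "z \<in> ball z0 \<rho>" for z
  proof -
    have zV: "z \<in> cmap c ` cdom c" using z ballV by (rule subsetD[rotated])
    show "cinv c z \<in> cdom c" "cmap c (cinv c z) = z" using cinv_in_domain[OF zV] cmap_cinv[OF zV] by auto
    show "chart_bounds \<kappa> c (cinv c z)" using cx(5)[folded z0_def] z ball by blast
    obtain y where y: "f (cinv c z) = cinv c' y" "y \<in> ball (cmap c' (f x)) (1 / \<kappa>)"
      using expanding_map_maps_chart_ball[OF f \<Gamma> c \<rho>(2,3) z[unfolded z0_def]] by (rule imageE)
    have y': "y \<in> cball (cmap c' (f x)) (1 / \<kappa>)" using y(2) by simp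
    show "chart_bounds \<kappa> c' (f (cinv c z))" unfolding y(1) by (rule cfx(5)[OF y'])
    show "f (cinv c z) \<in> cdom c'" unfolding y(1) by (rule cinv_in_domain[OF subsetD[OF cfx(4) y']])
  qed
  have ballS: "ball z0 \<rho> \<subseteq> S"
  proof
    fix z assume z: "z \<in> ball z0 \<rho>"
    show "z \<in> S" unfolding S_def
      by (rule image_eqI[of _ _ "cinv c z"]) (use dom[OF z] in auto)
  qed
  have z0: "z0 \<in> ball z0 \<rho>" using \<rho>(1) by simp
  have x: "cinv c z0 = x" unfolding z0_def by (rule cinv_cmap[OF cx(2,3)])
  have Fz0: "F z0 = cmap c' (f x)" by (simp add: F_def loc_rep_def x)
  have der: "(F has_derivative F' z) (at z)" if "z \<in> ball z0 \<rho>" for z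
    unfolding F'_def[abs_def] using Ck_on_Suc_has_derivative[OF C2] ballS that by blast
  have F'_tangent: "F' z v = tangent_map c f c' (cinv c z) v" if "z \<in> ball z0 \<rho>" for z v
    using dom(3)[OF that] by (simp add: F'_def tangent_map_def F_def)
  have low: "1 / \<kappa>\<^sup>2 * norm v \<le> norm (F' z v)" if z: "z \<in> ball z0 \<rho>" for z v
    using tangent_map_norm_bounds(1)[OF f cx(2) cfx(2) dom(1,2)[OF z] dom(4,5)[OF z] cx(1) lam \<Gamma>, of v] cx(1)
    by (simp add: F'_tangent[OF z] field_simps)
  have near: "norm (F' z v - F' z0 v) \<le> 1 / \<kappa>\<^sup>2 / 2 * norm v" if z: "z \<in> ball z0 \<rho>" for z v
  proof -
    define H where "H z u = frechet_derivative (\<lambda>x. frechet_derivative F (at x) v) (at z) u" for z u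
    have K: "0 \<le> K" using cx(1) \<Gamma> by (simp add: K_def)
    have "norm (F' z v - F' z0 v) \<le> (K * norm v) * norm (z - z0)"
    proof (rule differentiable_bound[OF convex_ball _ _ z z0])
      fix y assume y: "y \<in> ball z0 \<rho>"
      have "((\<lambda>z. F' z v) has_derivative H y) (at y)"
        using C2 ballS y unfolding F'_def H_def[abs_def] by (auto simp: frechet_derivative_works)
      then show "((\<lambda>z. F' z v) has_derivative H y) (at y within ball z0 \<rho>)" by (rule has_derivative_at_withinI)
      show "onorm (H y) \<le> K * norm v"
      proof (rule onorm_le)
        fix u show "norm (H y u) \<le> K * norm v * norm u"
          using second_derivative_bound[OF f cx(2) cfx(2) dom(1,2)[OF y] dom(4,5)[OF y] cx(1) lam \<Gamma>, of v u]
          by (simp add: dom(3)[OF y] H_def F_def K_def ac_simps)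
      qed
    qed
    also have "\<dots> \<le> (K * norm v) * \<rho>"
      using z K by (intro mult_left_mono) (auto simp: dist_norm norm_minus_commute)
    also have "\<dots> = (K * \<rho>) * norm v" by simp
    also have "\<dots> \<le> 1 / \<kappa>\<^sup>2 / 2 * norm v" using \<rho>(4) by (intro mult_right_mono) (auto simp: K_def)
    finally show ?thesis .
  qed
  have \<alpha>: "1 / \<kappa>\<^sup>2 > 0" "1 / \<kappa>\<^sup>2 \<le> 1" using cx(1) by (simp_all add: field_simps)
  have inverse: "\<And>z w. z \<in> ball z0 \<rho> \<Longrightarrow> w \<in> ball z0 \<rho> \<Longrightarrow> 1 / \<kappa>\<^sup>2 / 2 * norm (z - w) \<le> norm (F z - F w)"
    "ball (F z0) (1 / \<kappa>\<^sup>2 * \<rho> / 2) \<subseteq> F ` ball z0 \<rho>"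
    using quantitative_inverse[where F = F and F' = F', OF \<rho>(1) \<alpha>(1) der low[OF z0] near] by blast+
  have r: "0 < r" "r \<le> 1 / \<kappa>" "ball (F z0) r \<subseteq> F ` ball z0 \<rho>"
  proof -
    show "0 < r" using \<alpha>(1) \<rho>(1) by (simp add: r_def)
    have "1 / \<kappa>\<^sup>2 * \<rho> \<le> 1 * \<rho>" using \<alpha>(2) \<rho>(1) by (intro mult_right_mono) auto
    then show "r \<le> 1 / \<kappa>" using \<rho>(1,2) by (simp add: r_def)
    show "ball (F z0) r \<subseteq> F ` ball z0 \<rho>" using inverse(2) by (simp add: r_def)
  qed
  \<comment> \<open>The first distance bound places \<open>y\<close> in the ball on which \<open>f\<close> is injective; the second one keeps
    curves between the images in the domain of the local inverse.\<close>
  have y_ball: "y \<in> cinv c ` ball z0 \<rho>"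
  proof -
    obtain a b \<gamma> where \<gamma>: "a \<le> b" "piecewise_C1_curve M A a b \<gamma>" "\<gamma> a = x" "\<gamma> b = y"
      "curve_length A g a b \<gamma> < \<rho> / \<kappa>"
      using riem_dist_less_imp_curve[OF conn xy d(1)] by blast
    show ?thesis
      using short_curve_stays_in_controlled_ball[OF \<gamma>(2) _ \<rho>(1,2) \<gamma>(5), of c b] c(1) \<gamma>(1,3,4)
      by (simp add: z0_def)
  qed
  have lifted: "lam * riem_dist M A g x y \<le> curve_length A g a b \<gamma>"
    if \<gamma>: "a \<le> b" "piecewise_C1_curve M A a b \<gamma>" "\<gamma> a = f x" "\<gamma> b = f y" "curve_length A g a b \<gamma> < r / \<kappa>"
    for a b \<gamma>
  proof -
    have \<gamma>U: "\<gamma> \<tau> \<in> cdom c' \<and> cmap c' (\<gamma> \<tau>) \<in> ball (F z0) r" if \<tau>: "\<tau> \<in> {a..b}" for \<tau>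
    proof -
      have "\<gamma> \<tau> \<in> cinv c' ` ball (F z0) r"
        using short_curve_stays_in_controlled_ball[OF \<gamma>(2) _ r(1,2) \<gamma>(5) \<tau>, of c'] c(2) \<gamma>(3) by (simp add: Fz0)
      then obtain w where w: "\<gamma> \<tau> = cinv c' w" "w \<in> ball (F z0) r" by (rule imageE)
      have "w \<in> cball (cmap c' (f x)) (1 / \<kappa>)" using w(2) r(2) by (simp add: Fz0)
      then have "w \<in> cmap c' ` cdom c'" using cfx(4) by (rule subsetD[rotated])
      then show ?thesis using w cinv_in_domain[of w c'] cmap_cinv[of w c'] by simp
    qed
    obtain \<sigma> where \<sigma>: "piecewise_C1_curve M A a b \<sigma>"
      "\<And>\<tau>. \<tau> \<in> {a..b} \<Longrightarrow> \<sigma> \<tau> \<in> cinv c ` ball z0 \<rho> \<and> f (\<sigma> \<tau>) = \<gamma> \<tau>"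
      "lam * curve_length A g a b \<sigma> \<le> curve_length A g a b \<gamma>"
    proof (rule lift_curve_through_local_inverse[OF f _ cx(2) cfx(2) ballS[unfolded S_def] _ _ _
          open_ball r(3)[unfolded F_def] \<gamma>(2)])
      show "0 < lam" using lam by simp
      show "0 < 1 / \<kappa>\<^sup>2 / 2" using \<alpha>(1) by simp
      show "1 / \<kappa>\<^sup>2 / 2 * norm (z - w) \<le> norm (loc_rep c f c' z - loc_rep c f c' w)"
        if "z \<in> ball z0 \<rho>" "w \<in> ball z0 \<rho>" for z w
        using inverse(1)[OF that] by (simp add: F_def)
      show "1 / \<kappa>\<^sup>2 / 2 * norm v \<le> norm (frechet_derivative (loc_rep c f c') (at z) v)"
        if "z \<in> ball z0 \<rho>" for z v
      proof -
        have "1 / \<kappa>\<^sup>2 / 2 \<le> 1 / \<kappa>\<^sup>2" by (intro less_imp_le positive_half_less \<alpha>(1))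
        then have "1 / \<kappa>\<^sup>2 / 2 * norm v \<le> 1 / \<kappa>\<^sup>2 * norm v" by (rule mult_right_mono) simp
        then show ?thesis using low[OF that, of v] by (simp add: F'_def F_def)
      qed
    qed (use \<gamma>U in \<open>auto simp: F_def\<close>)
    have unique: "p = q" if pq: "p \<in> cinv c ` ball z0 \<rho>" "q \<in> cinv c ` ball z0 \<rho>" "f p = f q" for p q
    proof -
      obtain z w where zw: "p = cinv c z" "q = cinv c w" "z \<in> ball z0 \<rho>" "w \<in> ball z0 \<rho>"
        using pq(1,2) by blast
      have "F z = F w" using pq(3) by (simp add: F_def loc_rep_def zw(1,2))
      then have le: "1 / \<kappa>\<^sup>2 / 2 * norm (z - w) \<le> 0" using inverse(1)[OF zw(3,4)] by simp
      have "z = w"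
      proof (rule ccontr)
        assume "z \<noteq> w"
        then have "0 < 1 / \<kappa>\<^sup>2 / 2 * norm (z - w)" using \<alpha>(1) by (intro mult_pos_pos) simp_all
        then show False using le by (meson not_less)
      qed
      then show ?thesis by (simp add: zw(1,2))
    qed
    have "x \<in> cinv c ` ball z0 \<rho>" using x z0 by (metis image_eqI)
    \<comment> \<open>The end points of the lift lie in the ball on which \<open>f\<close> is injective.\<close>
    then have "\<sigma> a = x" "\<sigma> b = y"
      using \<sigma>(2)[of a] \<sigma>(2)[of b] \<gamma>(1,3,4) y_ball by (auto intro!: unique)
    then have "riem_dist M A g x y \<le> curve_length A g a b \<sigma>"
      using riem_dist_le_curve_length[OF \<gamma>(1) \<sigma>(1)] by blast
    then have "lam * riem_dist M A g x y \<le> lam * curve_length A g a b \<sigma>"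
      using lam by (intro mult_left_mono) auto
    then show ?thesis using \<sigma>(3) by linarith
  qed
  show ?thesis
  proof (rule ccontr)
    assume "\<not> ?thesis"
    then have lt: "riem_dist M A g (f x) (f y) < min (r / \<kappa>) (lam * riem_dist M A g x y)"
      using d(2) by (simp add: r_def)
    have fxy: "f x \<in> M" "f y \<in> M" using expanding_mapsD(2)[OF f] xy by auto
    obtain a b \<gamma> where \<gamma>: "a \<le> b" "piecewise_C1_curve M A a b \<gamma>" "\<gamma> a = f x" "\<gamma> b = f y"
      "curve_length A g a b \<gamma> < min (r / \<kappa>) (lam * riem_dist M A g x y)"
      using riem_dist_less_imp_curve[OF conn fxy lt] by blast
    then show False using lifted[OF \<gamma>(1-4)] by simp
  qed
qed

text \<open>
  The scale is chosen before the map: the conditions on the radius \<open>\<rho>\<close> involve only \<open>\<kappa>\<close>, which comes from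
  the manifold, and \<open>\<Gamma>\<close>.
\<close>

lemma uniform_expansion_at_small_scales:
  assumes "compact M" "connected M" "1 \<le> lam" "0 < \<Gamma>"
  obtains \<delta> where "\<delta> > 0"
    "\<And>f x y. f \<in> expanding_maps M A g lam \<Gamma> \<Longrightarrow> x \<in> M \<Longrightarrow> y \<in> M \<Longrightarrow>
      riem_dist M A g x y < \<delta> \<Longrightarrow> riem_dist M A g (f x) (f y) < \<delta> \<Longrightarrow>
      lam * riem_dist M A g x y \<le> riem_dist M A g (f x) (f y)"
proof -
  obtain \<kappa> where \<kappa>: "1 \<le> \<kappa>" "\<And>x. x \<in> M \<Longrightarrow> \<exists>c. controlled_chart \<kappa> c x"
    using uniformly_controlled_charts[OF assms(1)] by blast
  define K where "K = \<kappa>^3 * \<Gamma> + \<kappa> * (\<kappa>\<^sup>2 * \<Gamma>)\<^sup>2 + \<kappa>^3 * \<Gamma>"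
  have K: "K > 0" using \<kappa>(1) assms(4) by (simp add: K_def add_pos_nonneg)
  \<comment> \<open>The three bounds on the radius \<open>\<rho>\<close>: the ball stays in the chart, its image stays in the chart
    around \<open>f x\<close>, and the derivative varies on it by at most half of its lower bound \<open>1 / \<kappa>\<^sup>2\<close>.\<close>
  define \<rho> where "\<rho> = min (1 / \<kappa>) (min (1 / (2 * \<Gamma> * \<kappa>^3)) (1 / \<kappa>\<^sup>2 / 2 / K))"
  have "\<kappa> > 0" using \<kappa>(1) by simp
  then have \<rho>: "0 < \<rho>" "\<rho> \<le> 1 / \<kappa>" using assms(4) K by (simp_all add: \<rho>_def)
  have "\<Gamma> * \<kappa> * \<rho> \<le> \<Gamma> * \<kappa> * (1 / (2 * \<Gamma> * \<kappa>^3))"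
    using \<kappa>(1) assms(4) by (intro mult_left_mono) (auto simp: \<rho>_def)
  also have "\<dots> = 1 / \<kappa> / \<kappa> / 2" using \<open>\<kappa> > 0\<close> assms(4) by (simp add: power3_eq_cube)
  also have "\<dots> < 1 / \<kappa> / \<kappa>"
    by (rule positive_half_less) (use \<open>\<kappa> > 0\<close> in simp)
  finally have \<rho>3: "\<Gamma> * \<kappa> * \<rho> < 1 / \<kappa> / \<kappa>" .
  have "K * \<rho> \<le> K * (1 / \<kappa>\<^sup>2 / 2 / K)" using K by (intro mult_left_mono) (auto simp: \<rho>_def)
  then have \<rho>4: "K * \<rho> \<le> 1 / \<kappa>\<^sup>2 / 2" using K by simp
  define \<delta> where "\<delta> = min (\<rho> / \<kappa>) (1 / \<kappa>\<^sup>2 * \<rho> / 2 / \<kappa>)"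
  have "\<delta> > 0" using \<open>\<kappa> > 0\<close> \<rho>(1) by (simp add: \<delta>_def)
  moreover have "lam * riem_dist M A g x y \<le> riem_dist M A g (f x) (f y)"
    if f: "f \<in> expanding_maps M A g lam \<Gamma>" and xy: "x \<in> M" "y \<in> M"
      and d: "riem_dist M A g x y < \<delta>" "riem_dist M A g (f x) (f y) < \<delta>" for f x y
  proof -
    have "f x \<in> M" using expanding_mapsD(2)[OF f] xy(1) by blast
    then obtain c c' where c: "controlled_chart \<kappa> c x" "controlled_chart \<kappa> c' (f x)"
      using \<kappa>(2) xy(1) by meson
    show ?thesis
      using d assms(4)
      by (intro expanding_map_local_expansion[OF assms(2) f assms(3) _ c \<rho> \<rho>3 \<rho>4[unfolded K_def] xy])
        (simp_all add: \<delta>_def)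
  qed
  ultimately show ?thesis using that by blast
qed

lemma orbit_map_in: "(\<And>n. f n ` M \<subseteq> M) \<Longrightarrow> x \<in> M \<Longrightarrow> orbit_map f i j x \<in> M"
  by (induction j) (auto simp: image_subset_iff)

text \<open>
  Each step multiplies the distance by at least \<open>lam\<close>, because at every time both the current and the next
  distance are below the scale \<open>\<delta>\<close>.
\<close>

lemma close_orbits_expand:
  assumes f: "\<And>n. f n \<in> expanding_maps M A g lam \<Gamma>" and "0 \<le> lam"
    and exp: "\<And>h x y. h \<in> expanding_maps M A g lam \<Gamma> \<Longrightarrow> x \<in> M \<Longrightarrow> y \<in> M \<Longrightarrow>
      riem_dist M A g x y < \<delta> \<Longrightarrow> riem_dist M A g (h x) (h y) < \<delta> \<Longrightarrow>
      lam * riem_dist M A g x y \<le> riem_dist M A g (h x) (h y)"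
    and xy: "x \<in> M" "y \<in> M"
    and close: "\<And>j. j \<le> N \<Longrightarrow> riem_dist M A g (orbit_map f i j x) (orbit_map f i j y) < \<delta>"
  shows "lam ^ N * riem_dist M A g x y \<le> riem_dist M A g (orbit_map f i N x) (orbit_map f i N y)"
  using close
proof (induction N)
  case 0
  then show ?case by simp
next
  case (Suc N)
  let ?x = "orbit_map f i N x" and ?y = "orbit_map f i N y"
  have M: "?x \<in> M" "?y \<in> M" using expanding_mapsD(2)[OF f] xy by (auto intro: orbit_map_in)
  have "lam ^ Suc N * riem_dist M A g x y = lam * (lam ^ N * riem_dist M A g x y)" by simp
  also have "\<dots> \<le> lam * riem_dist M A g ?x ?y"
    using Suc assms(2) by (intro mult_left_mono) auto
  also have "\<dots> \<le> riem_dist M A g (f (i + N) ?x) (f (i + N) ?y)"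
    using Suc.prems[of N] Suc.prems[of "Suc N"] by (intro exp f M) simp_all
  finally show ?case by simp
qed

end

theorem proposition7p14:
  fixes M :: "'a::t2_space set"
    and A :: "('a, 'e::euclidean_space) chart set"
    and g :: "('a, 'e) metric_tensor"
    and lam \<Gamma> :: real
    and f :: "nat \<Rightarrow> 'a \<Rightarrow> 'a"
  assumes "riemannian_manifold M A g"
    and "compact M"
    and "connected M"
    and "1 < lam"
    and "lam < \<Gamma>"
    and "\<And>n. f n \<in> expanding_maps M A g lam \<Gamma>"
  shows "strongly_uniformly_expansive M (riem_dist M A g) f"
proof -
  interpret riemannian_manifold M A g by (rule assms(1))
  let ?d = "riem_dist M A g"
  have lam: "1 \<le> lam" "0 \<le> lam" and \<Gamma>: "0 < \<Gamma>" using assms(4,5) by auto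
  obtain \<delta> where \<delta>: "\<delta> > 0"
    "\<And>h x y. h \<in> expanding_maps M A g lam \<Gamma> \<Longrightarrow> x \<in> M \<Longrightarrow> y \<in> M \<Longrightarrow>
      ?d x y < \<delta> \<Longrightarrow> ?d (h x) (h y) < \<delta> \<Longrightarrow> lam * ?d x y \<le> ?d (h x) (h y)"
    using uniform_expansion_at_small_scales[OF assms(2,3) lam(1) \<Gamma>] by blast
  show ?thesis
    unfolding strongly_uniformly_expansive_def
  proof (intro exI[of _ \<delta>] conjI allI impI \<delta>(1))
    fix \<epsilon> :: real assume "\<epsilon> > 0"
    obtain n where n: "\<delta> / \<epsilon> < lam ^ n" using real_arch_pow[OF assms(4)] by blast
    define N where "N = Suc n"
    have "lam ^ n \<le> lam ^ N" using assms(4) by (intro power_increasing) (auto simp: N_def)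
    then have N: "\<delta> < lam ^ N * \<epsilon>" using n \<open>\<epsilon> > 0\<close> by (simp add: pos_divide_less_eq less_le_trans)
    have "?d x y < \<epsilon>" if xy: "x \<in> M" "y \<in> M" and b: "bowen_dist ?d f i N x y < \<delta>" for i x y
    proof -
      have close: "?d (orbit_map f i j x) (orbit_map f i j y) < \<delta>" if "j \<le> N" for j
        using b that unfolding bowen_dist_def by (subst (asm) Max_less_iff) auto
      have "lam ^ N * ?d x y \<le> ?d (orbit_map f i N x) (orbit_map f i N y)"
        by (rule close_orbits_expand[OF assms(6) lam(2) \<delta>(2) xy close])
      also have "\<dots> < \<delta>" by (rule close) simp
      also note N
      finally show ?thesis using assms(4) by simp
    qed
    then show "\<exists>N\<ge>1. \<forall>i. \<forall>x\<in>M. \<forall>y\<in>M. bowen_dist ?d f i N x y < \<delta> \<longrightarrow> ?d x y < \<epsilon>"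
      by (intro exI[of _ N]) (auto simp: N_def)
  qed
qed

end
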